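(* Let $f:\mathbb{R}\to(0,\infty)$ be an (unnormalised) univariate density with the following properties: $f$ is $C^4$ and unimodal with its maximum at $\mu\in\mathbb{R}$; $f(x)=e^{-H(x)}$ where $H$ is regularly varying, i.e. there is $\alpha>0$ such that $H(tx)/H(t)\to x^{\alpha}$ as $|t|\to\infty$ for every $x>0$; and there is $M>0$ with $|(\log f)''''(z)|<M$ for all $z\in\mathbb{R}$. For $d\ge 1$ let $f_d(x)=\prod_{i=1}^d f(x_i)$ on $\mathbb{R}^d$. Fix $\beta>0$ and $\ell>0$, put $\epsilon=\ell/d^{1/2}$ and $\beta'=\beta+\epsilon$, and consider the QuanTA swap move between inverse temperatures $\beta$ and $\beta'$ with acceptance probability $\alpha_\beta(x,y)$ and expected squared jumping distance $ESJD_\beta=\epsilon^2\,\mathbb{E}[\alpha_\beta(x,y)]$ as defined in the context. Then, in the limit as $d\to\infty$, $ESJD_\beta$ is maximised when $\ell$ is chosen to maximise $$2\ell^2\,\Phi\!\left(-\frac{\ell\left[I(\beta)-\tfrac12 V(\beta)-\tfrac{1}{4\beta}R(\beta)\right]^{1/2}}{\sqrt2}\right).$$ Furthermore, for the optimal $\ell$, the corresponding swap move acceptance rate between the two consecutive temperatures (the limit of $\mathbb{E}[\alpha_\beta(x,y)]$) is $0.234$ (to 3 significant figures).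
   Context: $\Phi$ is the standard normal CDF. For $a,b>0$ and $z\in\mathbb{R}^d$, define the transformation $g(z,a,b)\in\mathbb{R}^d$ coordinatewise by $g(z,a,b)_i=(a/b)^{1/2}(z_i-\mu)+\mu$. Let $x\sim f_d^{\beta}/\int f_d^{\beta}$ and $y\sim f_d^{\beta'}/\int f_d^{\beta'}$ be independent (the stationary states of the chains at inverse temperatures $\beta$ and $\beta'$). The swap move proposes to replace the state $x$ at level $\beta$ and $y$ at level $\beta'$ by $g(y,\beta',\beta)$ at level $\beta$ and $g(x,\beta,\beta')$ at level $\beta'$, and accepts with probability $$\alpha_\beta(x,y)=\min\left(1,\frac{f_d^{\beta'}(g(x,\beta,\beta'))\,f_d^{\beta}(g(y,\beta',\beta))}{f_d^{\beta'}(y)\,f_d^{\beta}(x)}\right).$$ $ESJD_\beta=\mathbb{E}[(\gamma-\beta)^2]$ where $\gamma=\beta+\epsilon$ if the swap is accepted and $\gamma=\beta$ otherwise; equivalently $ESJD_\beta=\epsilon^2\mathbb{E}[\alpha_\beta(x,y)]$. Write $h=\log f$, $k(x)=(x-\mu)h'(x)$, $r(x)=(x-\mu)^2h''(x)$, and let $\mathbb{E}_\beta,\mathrm{Var}_\beta,\mathrm{Cov}_\beta$ denote moments under the univariate density $f^\beta(x)/\int f^\beta$. Define $I(\beta)=\mathrm{Var}_\beta(h(X))$, $V(\beta)=\mathrm{Cov}_\beta(h(X),k(X))$, and $R(\beta)=\mathbb{E}_\beta[r(X)-k(X)]$. *)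

theory Defs
  imports "HOL-Probability.Probability"
begin

definition Phi :: "real \<Rightarrow> real" where
  "Phi x = (LBINT t:{..x}. std_normal_density t)"

definition C4 :: "(real \<Rightarrow> real) \<Rightarrow> bool" where
  "C4 f \<longleftrightarrow> (\<exists>D :: nat \<Rightarrow> real \<Rightarrow> real. D 0 = f \<and>
      (\<forall>k<4. \<forall>x. (D k has_real_derivative D (Suc k) x) (at x)) \<and>
      continuous_on UNIV (D 4))"

definition tmean :: "(real \<Rightarrow> real) \<Rightarrow> real \<Rightarrow> (real \<Rightarrow> real) \<Rightarrow> real" where
  "tmean f \<beta> u = (LINT x|lborel. u x * f x powr \<beta>) / (LINT x|lborel. f x powr \<beta>)"

definition hfun :: "(real \<Rightarrow> real) \<Rightarrow> real \<Rightarrow> real" where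
  "hfun f x = ln (f x)"

definition kfun :: "(real \<Rightarrow> real) \<Rightarrow> real \<Rightarrow> real \<Rightarrow> real" where
  "kfun f \<mu> x = (x - \<mu>) * deriv (hfun f) x"

definition rfun :: "(real \<Rightarrow> real) \<Rightarrow> real \<Rightarrow> real \<Rightarrow> real" where
  "rfun f \<mu> x = (x - \<mu>)\<^sup>2 * deriv (deriv (hfun f)) x"

definition Ifun :: "(real \<Rightarrow> real) \<Rightarrow> real \<Rightarrow> real" where
  "Ifun f \<beta> = tmean f \<beta> (\<lambda>x. (hfun f x)\<^sup>2) - (tmean f \<beta> (hfun f))\<^sup>2"

definition Vfun :: "(real \<Rightarrow> real) \<Rightarrow> real \<Rightarrow> real \<Rightarrow> real" where
  "Vfun f \<mu> \<beta> = tmean f \<beta> (\<lambda>x. hfun f x * kfun f \<mu> x)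
                 - tmean f \<beta> (hfun f) * tmean f \<beta> (kfun f \<mu>)"

definition Rfun :: "(real \<Rightarrow> real) \<Rightarrow> real \<Rightarrow> real \<Rightarrow> real" where
  "Rfun f \<mu> \<beta> = tmean f \<beta> (\<lambda>x. rfun f \<mu> x - kfun f \<mu> x)"

definition swap_g :: "real \<Rightarrow> (nat \<Rightarrow> real) \<Rightarrow> real \<Rightarrow> real \<Rightarrow> nat \<Rightarrow> real" where
  "swap_g \<mu> z a b = (\<lambda>i. sqrt (a / b) * (z i - \<mu>) + \<mu>)"

definition fd_pow :: "(real \<Rightarrow> real) \<Rightarrow> nat \<Rightarrow> real \<Rightarrow> (nat \<Rightarrow> real) \<Rightarrow> real" where
  "fd_pow f d \<beta> z = (\<Prod>i<d. f (z i) powr \<beta>)"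

definition swap_acc :: "(real \<Rightarrow> real) \<Rightarrow> real \<Rightarrow> nat \<Rightarrow> real \<Rightarrow> real
    \<Rightarrow> (nat \<Rightarrow> real) \<Rightarrow> (nat \<Rightarrow> real) \<Rightarrow> real" where
  "swap_acc f \<mu> d \<beta> \<beta>' x y =
     min 1 (fd_pow f d \<beta>' (swap_g \<mu> x \<beta> \<beta>') * fd_pow f d \<beta> (swap_g \<mu> y \<beta>' \<beta>)
            / (fd_pow f d \<beta>' y * fd_pow f d \<beta> x))"

definition stat_measure :: "(real \<Rightarrow> real) \<Rightarrow> real \<Rightarrow> real measure" where
  "stat_measure f \<beta> =
     density lborel (\<lambda>x. ennreal (f x powr \<beta> / (LINT z|lborel. f z powr \<beta>)))"

definition exp_acc :: "(real \<Rightarrow> real) \<Rightarrow> real \<Rightarrow> real \<Rightarrow> real \<Rightarrow> nat \<Rightarrow> real" where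
  "exp_acc f \<mu> \<beta> l d =
     (let \<beta>' = \<beta> + l / sqrt (real d) in
      integral\<^sup>L (PiM {..<d} (\<lambda>_. stat_measure f \<beta>) \<Otimes>\<^sub>M PiM {..<d} (\<lambda>_. stat_measure f \<beta>'))
        (\<lambda>(x, y). swap_acc f \<mu> d \<beta> \<beta>' x y))"

definition ESJD :: "(real \<Rightarrow> real) \<Rightarrow> real \<Rightarrow> real \<Rightarrow> real \<Rightarrow> nat \<Rightarrow> real" where
  "ESJD f \<mu> \<beta> l d = (l / sqrt (real d))\<^sup>2 * exp_acc f \<mu> \<beta> l d"

definition eff_lim :: "(real \<Rightarrow> real) \<Rightarrow> real \<Rightarrow> real \<Rightarrow> real \<Rightarrow> real" where
  "eff_lim f \<mu> \<beta> l = 2 * l\<^sup>2 * Phi (- l * sqrt (Ifun f \<beta> - Vfun f \<mu> \<beta> / 2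
                                   - Rfun f \<mu> \<beta> / (4 * \<beta>)) / sqrt 2)"

end

theory Submission
  imports Defs
begin

text \<open>Write \<open>\<phi>\<close> for the logarithm of \<open>f\<^sup>\<beta>' (g x) / f\<^sup>\<beta> x\<close>. After normalisation, \<open>exp \<phi>\<close> is a likelihood ratio: it is
  the density, with respect to the law \<open>P\<close> at \<open>\<beta>\<close>, of the law at \<open>\<beta>'\<close> pulled back along \<open>g\<close>. The log acceptance
  ratio is therefore a sum of \<open>d\<close> independent copies of \<open>\<phi>\<close> under \<open>P\<close> minus \<open>d\<close> independent copies of \<open>\<phi>\<close> under the tilted law.
  Since a likelihood ratio has mean one, the first-order terms of its characteristic function cancel, and by
  dominated convergence (\<open>h\<close> and its derivatives grow polynomially because the fourth derivative of \<open>h\<close> is bounded, while regular variation makes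
  \<open>f\<^sup>\<beta>\<close> decay faster than any polynomial) it tends to that of the normal law with mean \<open>- v / 2\<close> and variance \<open>v = 2 l\<^sup>2 \<sigma>\<^sup>2\<close>,
  where \<open>\<sigma>\<^sup>2 = Var (h - k / 2)\<close>. Stein's identity rewrites \<open>\<sigma>\<^sup>2\<close> as \<open>I - V / 2 - R / (4 \<beta>)\<close>, and the mean of
  \<open>min 1 (exp Z)\<close> under that normal law is \<open>2 \<Phi> (- sqrt v / 2)\<close>. At the maximiser of \<open>u\<^sup>2 \<Phi> (- u)\<close> one has
  \<open>2 \<Phi> (- u) = u \<Phi>' u\<close>, which pins down the rate numerically.\<close>

section \<open>The standard normal distribution\<close>

lemma Phi_eq_cdf: "Phi x = cdf std_normal_distribution x"
  unfolding Phi_def cdf_def set_lebesgue_integral_def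
  by (subst measure_def, subst emeasure_density, simp, simp)
     (subst integral_eq_nn_integral, auto intro!: arg_cong[where f=enn2real] nn_integral_cong split: split_indicator)

lemma std_normal_density_minus: "std_normal_density (- x) = std_normal_density x"
  by (simp add: std_normal_density_def)

lemma integrable_indicator_std_normal:
  "A \<in> sets borel \<Longrightarrow> integrable lborel (\<lambda>x. indicator A x * std_normal_density x)"
  using integrable_mult_indicator[of A lborel std_normal_density] integrable_std_normal_moment[of 0]
  by simp

text \<open>The half-line integral is split at \<open>x - 1\<close>. What depends on the upper limit
  is then an integral over a compact interval, to which the fundamental theorem of calculus applies;
  the splitting is valid near \<open>x\<close>, which suffices for the derivative.\<close>

lemma DERIV_Phi: "(Phi has_real_derivative std_normal_density x) (at x)"
proof -
  let ?n = "std_normal_density"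
  have cont: "continuous_on A ?n" for A
    unfolding std_normal_density_def by (intro continuous_intros) auto
  have eq: "Phi u = Phi (x - 1) + (LBINT y=ereal(x-1)..ereal u. ?n y)" if "u \<ge> x - 1" for u
  proof -
    have "(LBINT y=ereal(x-1)..ereal u. ?n y) = (LBINT y:{x-1<..u}. ?n y)"
      using that by (simp add: interval_integral_Ioc)
    moreover have "(LBINT y:{..x-1} \<union> {x-1<..u}. ?n y) = (LBINT y:{..x-1}. ?n y) + (LBINT y:{x-1<..u}. ?n y)"
      by (rule set_integral_Un)
         (auto simp: set_integrable_def intro!: integrable_indicator_std_normal)
    moreover have "{..x-1} \<union> {x-1<..u} = {..u}" using that by auto
    ultimately show ?thesis unfolding Phi_def by simp
  qed
  have "((\<lambda>u. LBINT y=ereal(x-1)..ereal u. ?n y) has_vector_derivative ?n x) (at x within {x-1..x+1})"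
    by (rule interval_integral_FTC2) (auto intro: cont)
  hence "((\<lambda>u. LBINT y=ereal(x-1)..ereal u. ?n y) has_real_derivative ?n x) (at x within {x-1<..<x+1})"
    by (auto simp: has_real_derivative_iff_has_vector_derivative intro: has_vector_derivative_within_subset)
  hence "((\<lambda>u. LBINT y=ereal(x-1)..ereal u. ?n y) has_real_derivative ?n x) (at x)"
    by (subst (asm) at_within_open) auto
  hence d: "((\<lambda>u. Phi (x-1) + (LBINT y=ereal(x-1)..ereal u. ?n y)) has_real_derivative ?n x) (at x)"
    by (auto intro!: derivative_eq_intros)
  have ev: "\<forall>\<^sub>F u in nhds x. Phi u = Phi (x - 1) + (LBINT y=ereal(x-1)..ereal u. ?n y)"
    by (rule eventually_mono[OF eventually_nhds_in_open[of "{x-1<..}" x]]) (auto intro: eq)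
  show ?thesis
    using DERIV_cong_ev[OF refl ev refl, of "std_normal_density x"] d by simp
qed

lemma Phi_tail: "(LBINT t:{x..}. std_normal_density t) = Phi (- x)"
  unfolding Phi_def set_lebesgue_integral_def
  by (subst lborel_integral_real_affine[where c="-1" and t=0])
     (auto intro!: Bochner_Integration.integral_cong simp: std_normal_density_minus split: split_indicator)

lemma Phi_minus: "Phi (- x) = 1 - Phi x"
proof -
  \<comment> \<open>The two half-lines overlap in the single point \<open>x\<close>, a null set, so
    the decomposition is an equality almost everywhere.\<close>
  have "(\<integral>t. std_normal_density t \<partial>lborel)
      = (\<integral>t. indicator {..x} t * std_normal_density t + indicator {x..} t * std_normal_density t \<partial>lborel)"
    using AE_lborel_singleton[of x]
    by (intro integral_cong_AE) (auto elim!: eventually_mono split: split_indicator)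
  also have "\<dots> = Phi x + Phi (- x)"
    unfolding Phi_tail[symmetric] unfolding Phi_def set_lebesgue_integral_def
    by (subst Bochner_Integration.integral_add) (auto intro: integrable_indicator_std_normal)
  finally show ?thesis using integral_std_normal_moment_even[of 0] by simp
qed

text \<open>On the half-line where the exponential is below 1, the tilted density
  \<open>exp (w x - w\<^sup>2/2)\<close> times the standard normal is the standard normal shifted by \<open>w\<close>.\<close>

lemma integral_min_exp_std_normal:
  assumes "w \<ge> 0"
  shows "(\<integral>x. min 1 (exp (w * x - w\<^sup>2 / 2)) \<partial>std_normal_distribution) = 2 * Phi (- w / 2)"
proof -
  let ?n = "std_normal_density"
  have tilt: "?n x * exp (w * x - w\<^sup>2 / 2) = ?n (x - w)" for x
    by (simp add: std_normal_density_def flip: exp_add)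
       (simp add: power2_eq_square field_simps)
  have "(\<integral>x. min 1 (exp (w * x - w\<^sup>2 / 2)) \<partial>std_normal_distribution)
      = (\<integral>x. ?n x * min 1 (exp (w * x - w\<^sup>2 / 2)) \<partial>lborel)"
    by (subst integral_density) auto
  \<comment> \<open>The exponent equals \<open>w * (x - w / 2)\<close> and changes sign at
    \<open>w / 2\<close>: to the left the minimum is the exponential, to the right it is 1.\<close>
  also have "\<dots> = (\<integral>x. indicator {w/2..} x * ?n x + indicator {..w/2} x * ?n (x - w) \<partial>lborel)"
  proof (rule integral_cong_AE)
    show "AE x in lborel. ?n x * min 1 (exp (w * x - w\<^sup>2 / 2))
        = indicator {w/2..} x * ?n x + indicator {..w/2} x * ?n (x - w)"
      using AE_lborel_singleton[of "w/2"]
    proof eventually_elim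
      case (elim x)
      show ?case
      proof (cases "x < w/2")
        case True
        then have "w * (x - w / 2) \<le> 0" using assms by (intro mult_nonneg_nonpos) auto
        then have "exp (w * x - w\<^sup>2 / 2) \<le> 1" by (simp add: power2_eq_square algebra_simps)
        then have "min 1 (exp (w * x - w\<^sup>2 / 2)) = exp (w * x - w\<^sup>2 / 2)" by (rule min_absorb2)
        then show ?thesis using True tilt[of x] by simp
      next
        case False
        then have "w * (x - w / 2) \<ge> 0" using assms by (intro mult_nonneg_nonneg) auto
        then have "exp (w * x - w\<^sup>2 / 2) \<ge> 1" by (simp add: power2_eq_square algebra_simps)
        then have "min 1 (exp (w * x - w\<^sup>2 / 2)) = 1" by (rule min_absorb1)
        then show ?thesis using False elim by simp
      qed
    qed
  qed auto
  also have "\<dots> = (\<integral>x. indicator {w/2..} x * ?n x \<partial>lborel) + (\<integral>x. indicator {..w/2} x * ?n (x - w) \<partial>lborel)"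
  proof (rule Bochner_Integration.integral_add)
    have "integrable lborel (\<lambda>x. ?n (- w + 1 * x))"
      using integrable_std_normal_moment[of 0] by (intro lborel_integrable_real_affine) auto
    then show "integrable lborel (\<lambda>x. indicator {..w/2} x * ?n (x - w))"
      using integrable_mult_indicator[of "{..w/2}" lborel "\<lambda>x. ?n (- w + x)"] by simp
  qed (auto intro: integrable_indicator_std_normal)
  also have "(\<integral>x. indicator {..w/2} x * ?n (x - w) \<partial>lborel) = Phi (- w / 2)"
    unfolding Phi_def set_lebesgue_integral_def
    by (subst lborel_integral_real_affine[where c=1 and t=w])
       (auto intro!: Bochner_Integration.integral_cong split: split_indicator)
  also have "(\<integral>x. indicator {w/2..} x * ?n x \<partial>lborel) = Phi (- w / 2)"
    using Phi_tail[of "w/2"] by (simp add: set_lebesgue_integral_def)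
  finally show ?thesis by simp
qed

section \<open>The optimal rate\<close>

lemma DERIV_std_normal_density:
  "(std_normal_density has_real_derivative - x * std_normal_density x) (at x)"
proof -
  have "((\<lambda>x. exp (- x\<^sup>2 / 2)) has_real_derivative - x * exp (- x\<^sup>2 / 2)) (at x)"
    by (auto intro!: derivative_eq_intros)
  from DERIV_cmult[OF this, of "1 / sqrt (2 * pi)"] show ?thesis
    unfolding std_normal_density_def by simp
qed

text \<open>For \<open>y \<ge> 0\<close> the Lagrange remainder of order 7 is nonpositive and that
  of order 8 is nonnegative, so consecutive Maclaurin polynomials bracket \<open>exp (- y)\<close>.
  At the arguments near 0.7 used later the bracket is tight enough for the required digits.\<close>

lemma exp_minus_bounds:
  fixes y :: real
  assumes "y \<ge> 0"
  shows "exp (- y) \<le> 1 - y + y^2/2 - y^3/6 + y^4/24 - y^5/120 + y^6/720"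
    and "exp (- y) \<ge> 1 - y + y^2/2 - y^3/6 + y^4/24 - y^5/120 + y^6/720 - y^7/5040"
proof -
  obtain t where "exp (- y) = (\<Sum>m<7. (- y) ^ m / fact m) + (exp t / fact 7) * (- y) ^ 7"
    using Maclaurin_exp_le by blast
  moreover have "(exp t / fact 7) * (- y) ^ 7 \<le> 0"
    using assms by (intro mult_nonneg_nonpos) (auto simp: power_minus_odd)
  ultimately show "exp (- y) \<le> 1 - y + y^2/2 - y^3/6 + y^4/24 - y^5/120 + y^6/720"
    by (simp add: eval_nat_numeral fact_numeral algebra_simps)
  obtain t where "exp (- y) = (\<Sum>m<8. (- y) ^ m / fact m) + (exp t / fact 8) * (- y) ^ 8"
    using Maclaurin_exp_le by blast
  moreover have "(exp t / fact 8) * (- y) ^ 8 \<ge> 0"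
    by (intro mult_nonneg_nonneg) auto
  ultimately show "exp (- y) \<ge> 1 - y + y^2/2 - y^3/6 + y^4/24 - y^5/120 + y^6/720 - y^7/5040"
    by (simp add: eval_nat_numeral fact_numeral algebra_simps)
qed

lemma sqrt_2pi_bounds: "2.50662 < sqrt (2 * pi)" "sqrt (2 * pi) < 2.50663"
  by (rule real_less_rsqrt real_less_lsqrt; use pi_approx in \<open>simp add: power2_eq_square\<close>)+

lemma sqrt_2pi_std_normal_density: "sqrt (2 * pi) * std_normal_density x = exp (- (x\<^sup>2 / 2))"
  by (simp add: std_normal_density_def)

lemma Phi_0: "Phi 0 = 1/2"
  using Phi_minus[of 0] by simp

text \<open>The polynomial is the termwise antiderivative of a Maclaurin polynomial of
  \<open>exp (- t\<^sup>2 / 2)\<close> that lies above it, so \<open>D\<close> is nondecreasing from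
  its value at 0. Multiplying by \<open>sqrt (2 * pi)\<close> keeps the coefficients rational. The
  upper bound is the mirror image with one more term.\<close>

lemma Phi_minus_lower:
  assumes "u \<ge> 0"
  shows "sqrt (2 * pi) * Phi (- u) \<ge> sqrt (2 * pi) / 2
    - (u - u^3/6 + u^5/40 - u^7/336 + u^9/3456 - u^11/42240 + u^13/599040)"
proof -
  define D where "D t = (t - t^3/6 + t^5/40 - t^7/336 + t^9/3456 - t^11/42240 + t^13/599040)
    - sqrt (2 * pi) * Phi t" for t
  have *: "\<exists>y. (D has_real_derivative y) (at x) \<and> 0 \<le> y" for x
  proof -
    have "((\<lambda>t. t - t^3/6 + t^5/40 - t^7/336 + t^9/3456 - t^11/42240 + t^13/599040)
        has_real_derivative 1 - x^2/2 + x^4/8 - x^6/48 + x^8/384 - x^10/3840 + x^12/46080) (at x)"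
      by (rule DERIV_cong, (rule DERIV_add DERIV_diff DERIV_ident DERIV_cdivide DERIV_pow)+) simp
    then have "(D has_real_derivative (1 - x^2/2 + x^4/8 - x^6/48 + x^8/384 - x^10/3840 + x^12/46080)
        - sqrt (2 * pi) * std_normal_density x) (at x)"
      unfolding D_def by (rule DERIV_diff[OF _ DERIV_cmult[OF DERIV_Phi]])
    moreover have "sqrt (2 * pi) * std_normal_density x
        \<le> 1 - x^2/2 + x^4/8 - x^6/48 + x^8/384 - x^10/3840 + x^12/46080"
      unfolding sqrt_2pi_std_normal_density using exp_minus_bounds[of "x\<^sup>2/2"]
      by (simp add: power_divide flip: power_mult)
    ultimately show ?thesis by (intro exI conjI) auto
  qed
  have "D 0 \<le> D u" by (rule DERIV_nonneg_imp_nondecreasing[OF assms *])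
  then show ?thesis unfolding D_def Phi_0 Phi_minus right_diff_distrib by simp
qed

lemma Phi_minus_upper:
  assumes "u \<ge> 0"
  shows "sqrt (2 * pi) * Phi (- u) \<le> sqrt (2 * pi) / 2
    - (u - u^3/6 + u^5/40 - u^7/336 + u^9/3456 - u^11/42240 + u^13/599040 - u^15/9676800)"
proof -
  define D where "D t = sqrt (2 * pi) * Phi t - (t - t^3/6 + t^5/40 - t^7/336 + t^9/3456
    - t^11/42240 + t^13/599040 - t^15/9676800)" for t
  have *: "\<exists>y. (D has_real_derivative y) (at x) \<and> 0 \<le> y" for x
  proof -
    have "((\<lambda>t. t - t^3/6 + t^5/40 - t^7/336 + t^9/3456 - t^11/42240 + t^13/599040 - t^15/9676800)
        has_real_derivative 1 - x^2/2 + x^4/8 - x^6/48 + x^8/384 - x^10/3840 + x^12/46080 - x^14/645120) (at x)"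
      by (rule DERIV_cong, (rule DERIV_add DERIV_diff DERIV_ident DERIV_cdivide DERIV_pow)+) simp
    then have "(D has_real_derivative sqrt (2 * pi) * std_normal_density x
        - (1 - x^2/2 + x^4/8 - x^6/48 + x^8/384 - x^10/3840 + x^12/46080 - x^14/645120)) (at x)"
      unfolding D_def by (rule DERIV_diff[OF DERIV_cmult[OF DERIV_Phi]])
    moreover have "sqrt (2 * pi) * std_normal_density x
        \<ge> 1 - x^2/2 + x^4/8 - x^6/48 + x^8/384 - x^10/3840 + x^12/46080 - x^14/645120"
      unfolding sqrt_2pi_std_normal_density using exp_minus_bounds[of "x\<^sup>2/2"]
      by (simp add: power_divide flip: power_mult)
    ultimately show ?thesis by (intro exI conjI) auto
  qed
  have "D 0 \<le> D u" by (rule DERIV_nonneg_imp_nondecreasing[OF assms *])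
  then show ?thesis unfolding D_def Phi_0 Phi_minus right_diff_distrib by simp
qed

text \<open>\<open>u\<^sup>2 Phi (- u)\<close> has derivative \<open>u * opt_gap u\<close>.\<close>

definition opt_gap :: "real \<Rightarrow> real" where
  "opt_gap u = 2 * Phi (- u) - u * std_normal_density u"

lemma DERIV_Phi_minus: "((\<lambda>u. Phi (- u)) has_real_derivative - std_normal_density x) (at x)"
  using DERIV_chain2[where f=Phi and g=uminus, OF DERIV_Phi DERIV_minus[OF DERIV_ident]]
  by (simp add: std_normal_density_minus)

text \<open>The factor \<open>x\<^sup>2 - 3\<close> governs the zeros: \<open>opt_gap\<close>
  decreases up to \<open>sqrt 3\<close> and afterwards increases towards its limit 0, so a positive
  zero must lie below \<open>sqrt 3\<close>.\<close>

lemma DERIV_opt_gap: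
  "(opt_gap has_real_derivative (x\<^sup>2 - 3) * std_normal_density x) (at x)"
  unfolding opt_gap_def
  by (auto intro!: derivative_eq_intros DERIV_Phi_minus DERIV_std_normal_density
      simp: algebra_simps power2_eq_square)

lemma opt_gap_tendsto_0: "(opt_gap \<longlongrightarrow> 0) at_top"
proof -
  interpret real_distribution std_normal_distribution by (rule real_dist_normal_dist)
  have "((\<lambda>u. Phi (- u)) \<longlongrightarrow> 0) at_top"
    unfolding Phi_eq_cdf
    by (rule filterlim_compose[OF cdf_lim_at_bot filterlim_uminus_at_bot_at_top])
  moreover have "((\<lambda>u. u * std_normal_density u) \<longlongrightarrow> 0) at_top"
    unfolding std_normal_density_def by real_asymp
  ultimately have "((\<lambda>u. 2 * Phi (- u) - u * std_normal_density u) \<longlongrightarrow> 2 * 0 - 0) at_top"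
    by (intro tendsto_diff tendsto_mult_left)
  then show ?thesis by (simp add: opt_gap_def[abs_def])
qed

lemma opt_gap_neg:
  assumes "u\<^sup>2 \<ge> 3" "u > 0"
  shows "opt_gap u < 0"
proof -
  have incr: "opt_gap a < opt_gap b" if "u \<le> a" "a < b" for a b
  proof (rule DERIV_pos_imp_increasing_open[OF that(2)])
    fix x assume "a < x"
    then have "u * u < x * x" using that assms by (intro mult_strict_mono) auto
    then have "(x\<^sup>2 - 3) * std_normal_density x > 0"
      using assms by (auto intro!: mult_pos_pos normal_density_pos simp: power2_eq_square)
    then show "\<exists>y. (opt_gap has_real_derivative y) (at x) \<and> y > 0"
      using DERIV_opt_gap by blast
  qed (auto intro!: DERIV_isCont[OF DERIV_opt_gap] continuous_at_imp_continuous_on)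
  \<comment> \<open>The limit alone yields only a weak inequality; passing through the point
    \<open>u + 1\<close> makes it strict at \<open>u\<close>.\<close>
  have "opt_gap (u + 1) \<le> 0"
    by (rule tendsto_lowerbound[OF opt_gap_tendsto_0])
       (auto intro!: eventually_mono[OF eventually_gt_at_top[of "u + 1"]] less_imp_le[OF incr])
  moreover have "opt_gap u < opt_gap (u + 1)" by (rule incr) auto
  ultimately show ?thesis by simp
qed

lemma opt_gap_antimono:
  assumes "0 \<le> a" "a \<le> b" "b\<^sup>2 \<le> 3"
  shows "opt_gap b \<le> opt_gap a"
proof (rule DERIV_nonpos_imp_nonincreasing[OF assms(2)])
  fix x assume "a \<le> x" "x \<le> b"
  then have "x * x \<le> b * b" using assms by (intro mult_mono) auto
  then have "(x\<^sup>2 - 3) * std_normal_density x \<le> 0"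
    using assms by (intro mult_nonpos_nonneg) (auto simp: power2_eq_square)
  then show "\<exists>y. (opt_gap has_real_derivative y) (at x) \<and> y \<le> 0"
    using DERIV_opt_gap by blast
qed

text \<open>At a zero of \<open>opt_gap\<close> the rate \<open>2 * Phi (- u)\<close> equals
  \<open>u * std_normal_density u\<close>. This monotonicity converts bounds on the zero into bounds
  on the rate.\<close>

lemma id_times_std_normal_density_antimono:
  assumes "1 \<le> a" "a \<le> b"
  shows "b * std_normal_density b \<le> a * std_normal_density a"
proof (rule DERIV_nonpos_imp_nonincreasing[OF assms(2), of "\<lambda>x. x * std_normal_density x"])
  fix x assume "a \<le> x" "x \<le> b"
  then have "1 * 1 \<le> x * x" using assms by (intro mult_mono) auto
  then have "(1 - x * x) * std_normal_density x \<le> 0"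
    by (intro mult_nonpos_nonneg) auto
  moreover have "((\<lambda>x. x * std_normal_density x) has_real_derivative (1 - x * x) * std_normal_density x) (at x)"
    by (auto intro!: derivative_eq_intros DERIV_std_normal_density simp: algebra_simps)
  ultimately show "\<exists>y. ((\<lambda>x. x * std_normal_density x) has_real_derivative y) (at x) \<and> y \<le> 0"
    by blast
qed

lemma opt_gap_scaled:
  "sqrt (2 * pi) * opt_gap u = 2 * (sqrt (2 * pi) * Phi (- u)) - u * exp (- (u\<^sup>2 / 2))"
  unfolding opt_gap_def sqrt_2pi_std_normal_density[symmetric] by (simp add: algebra_simps)

text \<open>The zero is close to 1.19. The two points are near enough to it that
  \<open>u * std_normal_density u\<close> stays between 0.2335 and 0.2345 on the whole
  bracket.\<close>

lemma opt_gap_sign: "opt_gap 1.185 > 0" "opt_gap 1.193 < 0"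
proof -
  have "sqrt (2 * pi) * opt_gap 1.185 > 0"
    unfolding opt_gap_scaled
    using Phi_minus_lower[of "1.185"] exp_minus_bounds(1)[of "1.185\<^sup>2/2"] sqrt_2pi_bounds
    by (simp add: power_divide) 
  then show "opt_gap 1.185 > 0" by (simp add: zero_less_mult_iff)
  have "sqrt (2 * pi) * opt_gap 1.193 < 0"
    unfolding opt_gap_scaled
    using Phi_minus_upper[of "1.193"] exp_minus_bounds(2)[of "1.193\<^sup>2/2"] sqrt_2pi_bounds
    by (simp add: power_divide) 
  then show "opt_gap 1.193 < 0" by (simp add: mult_less_0_iff)
qed

text \<open>A positive zero lies below \<open>sqrt 3\<close>, where \<open>opt_gap\<close>
  decreases, so the sign change traps it between 1.185 and 1.193. There the rate is read off from
  \<open>u * std_normal_density u\<close>, which avoids evaluating \<open>Phi\<close> at the unknown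
  point.\<close>

lemma optimal_acceptance_rate:
  assumes "u > 0" "opt_gap u = 0"
  shows "0.2335 \<le> 2 * Phi (- u)" "2 * Phi (- u) < 0.2345"
proof -
  have sq: "u\<^sup>2 < 3" using opt_gap_neg[of u] assms by force
  have 1: "u > 1.185"
  proof (rule ccontr)
    assume "\<not> ?thesis"
    then have "opt_gap 1.185 \<le> opt_gap u" using assms
      by (intro opt_gap_antimono) (auto simp: power2_eq_square)
    then show False using opt_gap_sign assms by simp
  qed
  have 2: "u < 1.193"
  proof (rule ccontr)
    assume "\<not> ?thesis"
    then have "opt_gap u \<le> opt_gap 1.193" using assms sq
      by (intro opt_gap_antimono) auto
    then show False using opt_gap_sign assms by simp
  qed
  have a: "2 * Phi (- u) = u * std_normal_density u" using assms by (simp add: opt_gap_def)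
  have "2.50663 * 0.2335 \<le> 1.193 * exp (- (1.193\<^sup>2/2) :: real)"
    using exp_minus_bounds(2)[of "1.193\<^sup>2/2"] by (simp add: power_divide)
  then have "sqrt (2 * pi) * 0.2335 \<le> sqrt (2 * pi) * (1.193 * std_normal_density 1.193)"
    using sqrt_2pi_bounds sqrt_2pi_std_normal_density[of "1.193"] by simp
  moreover have "1.193 * std_normal_density 1.193 \<le> u * std_normal_density u"
    using 1 2 by (intro id_times_std_normal_density_antimono) auto
  ultimately show "0.2335 \<le> 2 * Phi (- u)" unfolding a by simp
  have "2.50662 * 0.2345 > 1.185 * exp (- (1.185\<^sup>2/2) :: real)"
    using exp_minus_bounds(1)[of "1.185\<^sup>2/2"] by (simp add: power_divide)
  then have "sqrt (2 * pi) * (1.185 * std_normal_density 1.185) < sqrt (2 * pi) * 0.2345"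
    using sqrt_2pi_bounds sqrt_2pi_std_normal_density[of "1.185"] by simp
  then have "1.185 * std_normal_density 1.185 < 0.2345" by simp
  moreover have "u * std_normal_density u \<le> 1.185 * std_normal_density 1.185"
    using 1 2 by (intro id_times_std_normal_density_antimono) auto
  ultimately show "2 * Phi (- u) < 0.2345" unfolding a by simp
qed

lemma opt_gap_maximiser:
  assumes "\<kappa> > 0" "x > 0" and max: "\<And>l. l > 0 \<Longrightarrow> 2 * l\<^sup>2 * Phi (- l * \<kappa>) \<le> 2 * x\<^sup>2 * Phi (- x * \<kappa>)"
  shows "opt_gap (x * \<kappa>) = 0"
proof -
  have "((\<lambda>l. 2 * l\<^sup>2 * Phi (- (l * \<kappa>))) has_real_derivative 2 * x * opt_gap (x * \<kappa>)) (at x)"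
    unfolding opt_gap_def
    by (auto intro!: derivative_eq_intros DERIV_chain2[OF DERIV_Phi_minus] simp: algebra_simps power2_eq_square)
  \<comment> \<open>The ball of radius \<open>x\<close> around \<open>x\<close> stays inside the
    positive half-line, so the maximum over positive arguments is a local maximum and the derivative
    vanishes.\<close>
  moreover have "\<forall>y. \<bar>x - y\<bar> < x \<longrightarrow> 2 * y\<^sup>2 * Phi (- (y * \<kappa>)) \<le> 2 * x\<^sup>2 * Phi (- (x * \<kappa>))"
    using max by auto
  ultimately have "2 * x * opt_gap (x * \<kappa>) = 0"
    using DERIV_local_max assms(2) by blast
  then show ?thesis using assms by simp
qed

section \<open>Sums of log-likelihood ratios\<close>

text \<open>The bound on \<open>1 + a n\<close> forces \<open>Re (a n) \<le> 0\<close>, so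
  \<open>1 + a n\<close> and \<open>exp (a n)\<close> both lie in the closed unit disc. Their powers
  then differ by at most \<open>D n\<close> times the difference of the bases, which is of smaller
  order than \<open>a n\<close>.\<close>

lemma power_tendsto_exp:
  fixes a :: "nat \<Rightarrow> complex" and D :: "nat \<Rightarrow> nat"
  assumes D: "filterlim D at_top sequentially"
    and a: "(\<lambda>n. of_nat (D n) * a n) \<longlonglongrightarrow> L"
    and le1: "\<And>n. cmod (1 + a n) \<le> 1"
  shows "(\<lambda>n. (1 + a n) ^ D n) \<longlonglongrightarrow> exp L"
proof -
  have Dr: "filterlim (\<lambda>n. real (D n)) at_top sequentially"
    by (rule filterlim_compose[OF filterlim_real_sequentially D])
  have inv0: "(\<lambda>n. inverse (real (D n))) \<longlonglongrightarrow> 0"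
    by (rule tendsto_inverse_0_at_top[OF Dr])
  have pos: "\<forall>\<^sub>F n in sequentially. D n > 0"
    using D[unfolded filterlim_at_top, rule_format, of 1] by (auto elim!: eventually_mono)
  have "(\<lambda>n. (of_nat (D n) * a n) * of_real (inverse (real (D n)))) \<longlonglongrightarrow> L * of_real 0"
    by (intro tendsto_mult a tendsto_of_real inv0)
  moreover have "\<forall>\<^sub>F n in sequentially. (of_nat (D n) * a n) * of_real (inverse (real (D n))) = a n"
    using pos by eventually_elim simp
  ultimately have "a \<longlonglongrightarrow> L * of_real 0"
    by (rule Lim_transform_eventually)
  then have a0: "a \<longlonglongrightarrow> 0" by simp
  \<comment> \<open>\<open>g\<close> is the Caratheodory slope of \<open>exp\<close> at 0: it gives
    \<open>1 + a - exp a = a * (1 - g a)\<close> with \<open>g\<close> continuous at 0 and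
    \<open>g 0 = 1\<close>.\<close>
  obtain g :: "complex \<Rightarrow> complex" where g: "\<And>z. exp z - exp 0 = g z * (z - 0)" "isCont g 0" "g 0 = exp 0"
    using DERIV_exp[of "0::complex"] unfolding CARAT_DERIV by blast
  have bd: "cmod ((1 + a n) ^ D n - exp (of_nat (D n) * a n)) \<le> cmod (of_nat (D n) * a n) * cmod (1 - g (a n))" for n
  proof -
    have "1 + Re (a n) \<le> 1" using le1[of n] complex_Re_le_cmod[of "1 + a n"] by simp
    then have "cmod (exp (a n)) \<le> 1" by simp
    then have "cmod ((1 + a n) ^ D n - exp (a n) ^ D n) \<le> D n * cmod (1 + a n - exp (a n))"
      by (intro norm_power_diff le1)
    also have "1 + a n - exp (a n) = a n * (1 - g (a n))"
      using g(1)[of "a n"] by (simp add: algebra_simps)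
    also have "exp (a n) ^ D n = exp (of_nat (D n) * a n)"
      by (rule exp_of_nat_mult[symmetric])
    finally show ?thesis by (simp add: norm_mult mult.assoc)
  qed
  have "(\<lambda>n. g (a n)) \<longlonglongrightarrow> g 0" using a0 g(2) by (rule isCont_tendsto_compose[rotated])
  then have "(\<lambda>n. cmod (of_nat (D n) * a n) * cmod (1 - g (a n))) \<longlonglongrightarrow> cmod L * cmod (1 - g 0)"
    by (intro tendsto_intros a)
  then have "(\<lambda>n. cmod (of_nat (D n) * a n) * cmod (1 - g (a n))) \<longlonglongrightarrow> 0" using g(3) by simp
  then have "(\<lambda>n. (1 + a n) ^ D n - exp (of_nat (D n) * a n)) \<longlonglongrightarrow> 0"
    by (rule Lim_null_comparison[rotated]) (simp add: bd)
  from tendsto_add[OF this tendsto_exp[OF a]] show ?thesis by simp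
qed

text \<open>The weight \<open>1 + exp y\<close> covers linear growth on the left and exponential
  growth on the right, and it remains integrable when \<open>exp y\<close> is a likelihood ratio.
  For \<open>y \<ge> 0\<close> the bound is \<open>1 - y \<le> exp (- y)\<close> multiplied by
  \<open>exp y\<close>.\<close>

lemma abs_exp_minus_1_le: "\<bar>exp y - 1\<bar> \<le> \<bar>y\<bar> * (1 + exp y)" for y :: real
proof (cases "y \<ge> 0")
  case True
  have "1 - y \<le> exp (- y)" using exp_ge_add_one_self[of "- y"] by simp
  then have "(1 - y) * exp y \<le> 1" by (simp add: exp_minus field_simps)
  then show ?thesis using True by (simp add: algebra_simps)
next
  case False
  then have "- y * exp y \<ge> 0" by (intro mult_nonneg_nonneg) auto
  moreover have "\<bar>exp y - 1\<bar> = 1 - exp y" "\<bar>y\<bar> = - y" using False by auto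
  moreover have "- y * (1 + exp y) = - y + - y * exp y" by (simp add: algebra_simps)
  ultimately have "\<bar>y\<bar> * (1 + exp y) - \<bar>exp y - 1\<bar> = (exp y - 1 - y) + - y * exp y"
    by simp
  with \<open>- y * exp y \<ge> 0\<close> exp_ge_add_one_self[of y] show ?thesis by linarith
qed

text \<open>For \<open>y \<ge> 0\<close> the second-order remainder is controlled by
  \<open>exp y\<close>; for \<open>y < 0\<close> the third-order remainder is negative, whence
  \<open>exp y \<le> 1 + y + y\<^sup>2 / 2\<close>.\<close>

lemma abs_exp_minus_1_minus_le: "\<bar>exp y - 1 - y\<bar> \<le> y\<^sup>2 * (1 + exp y)" for y :: real
proof (cases "y \<ge> 0")
  case True
  obtain t where t: "\<bar>t\<bar> \<le> \<bar>y\<bar>" "exp y = (\<Sum>m<2. y ^ m / fact m) + exp t / fact 2 * y ^ 2"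
    using Maclaurin_exp_le by blast
  have "exp t * y\<^sup>2 \<le> exp y * y\<^sup>2" using t(1) True by (intro mult_right_mono) auto
  moreover have "exp y - 1 - y = exp t * y\<^sup>2 / 2" "exp t * y\<^sup>2 \<ge> 0"
    using t by (simp_all add: eval_nat_numeral)
  moreover have "exp y \<ge> 1 + y" by simp
  moreover have "y\<^sup>2 \<ge> 0" "y\<^sup>2 * (1 + exp y) = y\<^sup>2 + exp y * y\<^sup>2" by (simp_all add: algebra_simps)
  ultimately show ?thesis by linarith
next
  case False
  obtain t where t: "exp y = (\<Sum>m<3. y ^ m / fact m) + exp t / fact 3 * y ^ 3"
    using Maclaurin_exp_le by blast
  have "exp t * y ^ 3 \<le> 0" using False by (intro mult_nonneg_nonpos) (auto simp: power_less_zero_eq less_imp_le)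
  moreover have "exp y = 1 + y + y\<^sup>2 / 2 + exp t * y ^ 3 / 6"
    using t by (simp add: numeral_3_eq_3 numeral_2_eq_2)
  moreover have "y\<^sup>2 \<ge> 0" "y\<^sup>2 * exp y \<ge> 0" "y\<^sup>2 * (1 + exp y) = y\<^sup>2 + y\<^sup>2 * exp y"
    by (simp_all add: algebra_simps)
  ultimately show ?thesis using exp_ge_add_one_self[of y] by linarith
qed

text \<open>The compensated exponential: subtracting \<open>i t (exp y - 1)\<close>, which has mean zero under
  a likelihood ratio \<open>exp y\<close>, removes the first-order term.\<close>

definition cexp2 :: "real \<Rightarrow> real \<Rightarrow> complex" where
  "cexp2 t y = iexp (t * y) - 1 - \<i> * t * (exp y - 1)"

text \<open>Adding and subtracting \<open>\<i> * t * y\<close> splits \<open>cexp2\<close> into the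
  second-order Taylor remainders of the oscillating and of the real exponential.\<close>

lemma cexp2_bound: "cmod (cexp2 t y) \<le> (t\<^sup>2 + \<bar>t\<bar>) * (y\<^sup>2 * (1 + exp y))"
proof -
  have "cexp2 t y = (iexp (t * y) - (1 + \<i> * (t * y))) - \<i> * t * of_real (exp y - 1 - y)"
    by (simp add: cexp2_def algebra_simps)
  also have "cmod \<dots> \<le> cmod (iexp (t * y) - (1 + \<i> * (t * y))) + cmod (\<i> * t * of_real (exp y - 1 - y))"
    by (rule norm_triangle_ineq4)
  also have "cmod (iexp (t * y) - (1 + \<i> * (t * y))) \<le> \<bar>t * y\<bar>\<^sup>2 / 2"
    using iexp_approx1[of "t * y" 1] by (simp add: numeral_2_eq_2)
  also have "cmod (\<i> * t * of_real (exp y - 1 - y)) = \<bar>t\<bar> * \<bar>exp y - 1 - y\<bar>"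
    unfolding norm_mult norm_of_real by simp
  also have "\<dots> \<le> \<bar>t\<bar> * (y\<^sup>2 * (1 + exp y))"
    by (intro mult_left_mono abs_exp_minus_1_minus_le) auto
  also have "\<bar>t * y\<bar>\<^sup>2 / 2 \<le> t\<^sup>2 * (y\<^sup>2 * (1 + exp y))"
    by (simp add: power_mult_distrib algebra_simps)
  finally show ?thesis by (simp add: algebra_simps)
qed

text \<open>The linear terms cancel, so the quotient by \<open>y\<^sup>2\<close> extends
  continuously to 0. Its value there collects \<open>- t\<^sup>2 / 2\<close> from the oscillating
  exponential and \<open>- \<i> * t / 2\<close> from the compensator.\<close>

lemma cexp2_quadratic:
  "\<exists>R. (\<forall>y. cexp2 t y = R y * of_real (y\<^sup>2)) \<and> isCont R 0 \<and> R 0 = - (of_real (t\<^sup>2) + \<i> * t) / 2"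
proof -
  define c where "c = - (of_real (t\<^sup>2) + \<i> * t) / (2::complex)"
  define R where "R y = (if y = 0 then c else cexp2 t y / of_real (y\<^sup>2))" for y :: real
  \<comment> \<open>\<open>K\<close> adds the third-order remainder constants of the two
    exponentials, using \<open>exp \<bar>y\<bar> \<le> exp 1\<close> for
    \<open>\<bar>y\<bar> \<le> 1\<close>.\<close>
  define K where "K = \<bar>t\<bar> ^ 3 / 6 + \<bar>t\<bar> * exp 1 / 2"
  have cubic: "cmod (cexp2 t y - c * of_real (y\<^sup>2)) \<le> K * \<bar>y\<bar> ^ 3" if "\<bar>y\<bar> \<le> 1" for y
  proof -
    have "cexp2 t y - c * of_real (y\<^sup>2) = (iexp (t * y) - (1 + \<i> * (t * y) + (\<i> * (t * y))\<^sup>2 / 2))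
        - \<i> * t * of_real (exp y - (1 + y + y\<^sup>2 / 2))"
      by (simp add: cexp2_def c_def power_mult_distrib field_simps)
    also have "cmod \<dots> \<le> cmod (iexp (t * y) - (1 + \<i> * (t * y) + (\<i> * (t * y))\<^sup>2 / 2))
        + cmod (\<i> * t * of_real (exp y - (1 + y + y\<^sup>2 / 2)))"
      by (rule norm_triangle_ineq4)
    also have "cmod (iexp (t * y) - (1 + \<i> * (t * y) + (\<i> * (t * y))\<^sup>2 / 2)) \<le> \<bar>t * y\<bar> ^ 3 / 6"
      using iexp_approx1[of "t * y" 2] by (simp add: numeral_2_eq_2 numeral_3_eq_3)
    also have "cmod (\<i> * t * of_real (exp y - (1 + y + y\<^sup>2 / 2))) = \<bar>t\<bar> * \<bar>exp y - (1 + y + y\<^sup>2 / 2)\<bar>"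
      unfolding norm_mult norm_of_real by simp
    also have "\<bar>t\<bar> * \<bar>exp y - (1 + y + y\<^sup>2 / 2)\<bar> \<le> \<bar>t\<bar> * (exp 1 * \<bar>y\<bar> ^ 3 / 2)"
    proof (intro mult_left_mono)
      have "\<bar>exp y - (1 + y + y\<^sup>2 / 2)\<bar> \<le> exp \<bar>y\<bar> * \<bar>y\<bar> ^ 3 / 2"
        using Taylor_exp_field[of y 2] by (simp add: numeral_2_eq_2 numeral_3_eq_3)
      also have "\<dots> \<le> exp 1 * \<bar>y\<bar> ^ 3 / 2"
        using that by (intro divide_right_mono mult_right_mono) auto
      finally show "\<bar>exp y - (1 + y + y\<^sup>2 / 2)\<bar> \<le> exp 1 * \<bar>y\<bar> ^ 3 / 2" .
    qed simp
    finally show ?thesis by (simp add: K_def abs_mult power_mult_distrib algebra_simps)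
  qed
  have "(R \<longlongrightarrow> c) (at 0)"
  proof (rule Lim_transform_bound[where g="\<lambda>y. K * \<bar>y\<bar>" and f="\<lambda>y. R y - c", THEN Lim_null[THEN iffD2]])
    show "\<forall>\<^sub>F y in at 0. norm (R y - c) \<le> norm (K * \<bar>y\<bar>)"
      unfolding eventually_at
    proof (intro exI[of _ 1] conjI ballI impI)
      fix y :: real assume y: "y \<noteq> 0 \<and> dist y 0 < 1"
      have "R y - c = (cexp2 t y - c * of_real (y\<^sup>2)) / of_real (y\<^sup>2)"
        using y by (simp add: R_def field_simps)
      also have "norm \<dots> \<le> K * \<bar>y\<bar> ^ 3 / y\<^sup>2"
        unfolding norm_divide using cubic[of y] y by (auto intro!: divide_right_mono simp: dist_real_def norm_power)
      also have "\<dots> = K * \<bar>y\<bar>" using y by (simp add: power3_eq_cube power2_eq_square field_simps abs_mult_self_eq)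
      also have "\<dots> = norm (K * \<bar>y\<bar>)" by (simp add: K_def abs_mult)
      finally show "norm (R y - c) \<le> norm (K * \<bar>y\<bar>)" .
    qed simp
    show "((\<lambda>y. K * \<bar>y\<bar>) \<longlongrightarrow> 0) (at 0)" by (auto intro!: tendsto_eq_intros)
  qed
  moreover have "R 0 = c" by (simp add: R_def)
  ultimately have "isCont R 0" by (simp add: isCont_def)
  moreover have "cexp2 t y = R y * of_real (y\<^sup>2)" for y
    by (simp add: R_def cexp2_def)
  ultimately show ?thesis using \<open>R 0 = c\<close> unfolding c_def by blast
qed


text \<open>The \<open>\<phi> n\<close> are unnormalised log-likelihood ratios at step size
  \<open>\<epsilon> n\<close> with score \<open>s\<close>. \<open>W\<close> dominates the difference
  quotients and \<open>E\<close> the ratios themselves; \<open>int\<close> supplies the majorant for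
  every use of dominated convergence.\<close>

locale likelihood_family = prob_space P for P :: "'a measure" +
  fixes \<phi> :: "nat \<Rightarrow> 'a \<Rightarrow> real" and s W E :: "'a \<Rightarrow> real" and \<epsilon> :: "nat \<Rightarrow> real"
  assumes meas [measurable]: "\<And>n. \<phi> n \<in> borel_measurable P" "s \<in> borel_measurable P"
      "W \<in> borel_measurable P" "E \<in> borel_measurable P"
    and eps_pos: "\<And>n. \<epsilon> n > 0"
    and eps_lim: "\<epsilon> \<longlonglongrightarrow> 0"
    and lim: "\<And>x. (\<lambda>n. \<phi> n x / \<epsilon> n) \<longlonglongrightarrow> s x"
    and bound: "\<And>n x. \<bar>\<phi> n x\<bar> \<le> \<epsilon> n * W x"
    and exp_bound: "\<And>n x. exp (\<phi> n x) \<le> E x"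
    and int: "integrable P (\<lambda>x. (1 + W x)\<^sup>2 * (1 + E x))"
begin

definition norm_const :: "nat \<Rightarrow> real" where
  "norm_const n = (\<integral>x. exp (\<phi> n x) \<partial>P)"

definition logratio :: "nat \<Rightarrow> 'a \<Rightarrow> real" where
  "logratio n x = \<phi> n x - ln (norm_const n)"

definition smean :: real where "smean = (\<integral>x. s x \<partial>P)"

lemma W_nonneg: "W x \<ge> 0"
proof -
  have "0 \<le> \<epsilon> 0 * W x" using bound[of 0 x] by linarith
  then show ?thesis using eps_pos[of 0] by (simp add: zero_le_mult_iff)
qed

lemma E_pos: "E x > 0"
  using exp_bound[of 0 x] exp_gt_zero[of "\<phi> 0 x"] by linarith

lemma integrable_dominated:
  assumes "f \<in> borel_measurable P" and "\<And>x. norm (f x) \<le> C * ((1 + W x)\<^sup>2 * (1 + E x))"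
  shows "integrable P (f :: 'a \<Rightarrow> 'b :: {banach, second_countable_topology})"
proof (rule Bochner_Integration.integrable_bound[OF integrable_mult_right[OF int, of C] assms(1)])
  show "AE x in P. norm (f x) \<le> norm (C * ((1 + W x)\<^sup>2 * (1 + E x)))"
    using order_trans[OF assms(2) abs_ge_self] by simp
qed

lemma dominating_ge:
  shows "E x \<le> (1 + W x)\<^sup>2 * (1 + E x)" "W x * (1 + E x) \<le> (1 + W x)\<^sup>2 * (1 + E x)"
proof -
  note w = W_nonneg[of x] and e = E_pos[of x]
  have "1 + 2 * W x \<le> (1 + W x)\<^sup>2" by (simp add: power2_eq_square algebra_simps)
  then have *: "(1 + 2 * W x) * (1 + E x) \<le> (1 + W x)\<^sup>2 * (1 + E x)"
    using e by (intro mult_right_mono) auto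
  have "0 \<le> W x * E x" using w e by auto
  then show "E x \<le> (1 + W x)\<^sup>2 * (1 + E x)" "W x * (1 + E x) \<le> (1 + W x)\<^sup>2 * (1 + E x)"
    using * w e by (simp_all add: distrib_left distrib_right, linarith+)
qed

lemma integrable_exp: "integrable P (\<lambda>x. exp (\<phi> n x))"
  by (rule integrable_dominated[where C=1])
     (auto intro: order_trans[OF exp_bound dominating_ge(1)])

lemma norm_const_pos: "norm_const n > 0"
proof -
  have "norm_const n \<noteq> 0"
    unfolding norm_const_def
    by (subst integral_nonneg_eq_0_iff_AE[OF integrable_exp]) (auto simp: AE_False)
  moreover have "norm_const n \<ge> 0" unfolding norm_const_def by (rule integral_nonneg_AE) simp
  ultimately show ?thesis by linarith
qed

lemma logratio_measurable [measurable]: "logratio n \<in> borel_measurable P"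
  unfolding logratio_def[abs_def] by measurable

lemma exp_logratio: "exp (logratio n x) = exp (\<phi> n x) / norm_const n"
  using norm_const_pos[of n] by (simp add: logratio_def exp_diff)

lemma integrable_exp_logratio: "integrable P (\<lambda>x. exp (logratio n x))"
  unfolding exp_logratio using integrable_exp by simp

lemma integral_exp_logratio: "(\<integral>x. exp (logratio n x) \<partial>P) = 1"
  unfolding exp_logratio using norm_const_pos[of n] by (simp add: norm_const_def)

lemma phi_tendsto_0: "(\<lambda>n. \<phi> n x) \<longlonglongrightarrow> 0"
proof -
  have "(\<lambda>n. \<phi> n x / \<epsilon> n * \<epsilon> n) \<longlonglongrightarrow> s x * 0" by (intro tendsto_mult lim eps_lim)
  then show ?thesis using eps_pos by (simp add: less_imp_neq[OF eps_pos, symmetric])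
qed

text \<open>Differentiation under the integral sign: the quotients converge pointwise to
  \<open>s\<close> and are dominated by \<open>W x * (1 + E x)\<close>, thanks to
  \<open>abs_exp_minus_1_le\<close>.\<close>

lemma norm_const_deriv: "(\<lambda>n. (norm_const n - 1) / \<epsilon> n) \<longlonglongrightarrow> smean"
proof -
  obtain g :: "real \<Rightarrow> real" where g: "\<And>z. exp z - exp 0 = g z * (z - 0)" "isCont g 0" "g 0 = exp 0"
    using DERIV_exp[of "0::real"] unfolding CARAT_DERIV by blast
  have "(\<lambda>n. \<integral>x. (exp (\<phi> n x) - 1) / \<epsilon> n \<partial>P) \<longlonglongrightarrow> (\<integral>x. s x \<partial>P)"
  proof (rule integral_dominated_convergence)
    show "integrable P (\<lambda>x. W x * (1 + E x))"
      by (rule integrable_dominated[where C=1])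
         (use W_nonneg E_pos in \<open>auto simp: abs_mult dominating_ge(2) less_imp_le\<close>)
    show "AE x in P. (\<lambda>n. (exp (\<phi> n x) - 1) / \<epsilon> n) \<longlonglongrightarrow> s x"
    proof (rule AE_I2)
      fix x
      have "(\<lambda>n. g (\<phi> n x) * (\<phi> n x / \<epsilon> n)) \<longlonglongrightarrow> g 0 * s x"
        by (intro tendsto_mult lim isCont_tendsto_compose[OF g(2)] phi_tendsto_0)
      then show "(\<lambda>n. (exp (\<phi> n x) - 1) / \<epsilon> n) \<longlonglongrightarrow> s x"
        using g(1,3) by simp
    qed
    show "AE x in P. norm ((exp (\<phi> n x) - 1) / \<epsilon> n) \<le> W x * (1 + E x)" for n
    proof (rule AE_I2)
      fix x
      have "\<bar>exp (\<phi> n x) - 1\<bar> \<le> \<bar>\<phi> n x\<bar> * (1 + exp (\<phi> n x))" by (rule abs_exp_minus_1_le)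
      also have "\<dots> \<le> (\<epsilon> n * W x) * (1 + E x)"
        by (intro mult_mono bound add_left_mono exp_bound) (use eps_pos[of n] W_nonneg[of x] in \<open>auto simp: add_nonneg_nonneg\<close>)
      finally show "norm ((exp (\<phi> n x) - 1) / \<epsilon> n) \<le> W x * (1 + E x)"
        using eps_pos[of n] by (simp add: field_simps)
    qed
  qed measurable
  moreover have "(\<integral>x. (exp (\<phi> n x) - 1) / \<epsilon> n \<partial>P) = (norm_const n - 1) / \<epsilon> n" for n
    using integrable_exp by (simp add: norm_const_def prob_space)
  ultimately show ?thesis unfolding smean_def by (simp only:)
qed

lemma norm_const_lim: "norm_const \<longlonglongrightarrow> 1"
proof -
  have "(\<lambda>n. (norm_const n - 1) / \<epsilon> n * \<epsilon> n + 1) \<longlonglongrightarrow> smean * 0 + 1"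
    by (intro tendsto_intros norm_const_deriv eps_lim)
  then show ?thesis using eps_pos by (simp add: less_imp_neq[OF eps_pos, symmetric])
qed

lemma ln_norm_const_deriv: "(\<lambda>n. ln (norm_const n) / \<epsilon> n) \<longlonglongrightarrow> smean"
proof -
  obtain g :: "real \<Rightarrow> real" where g: "\<And>z. ln z - ln 1 = g z * (z - 1)" "isCont g 1" "g 1 = 1"
    using DERIV_ln[of "1::real"] unfolding CARAT_DERIV by auto
  have "(\<lambda>n. g (norm_const n) * ((norm_const n - 1) / \<epsilon> n)) \<longlonglongrightarrow> g 1 * smean"
    by (intro tendsto_mult norm_const_deriv isCont_tendsto_compose[OF g(2)] norm_const_lim)
  then show ?thesis using g(1,3) by simp
qed

text \<open>Normalising the ratio centres the score: \<open>ln (norm_const n)\<close> contributes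
  its mean, so squares of the limit integrate to the variance of \<open>s\<close>.\<close>

lemma logratio_deriv: "(\<lambda>n. logratio n x / \<epsilon> n) \<longlonglongrightarrow> s x - smean"
  unfolding logratio_def diff_divide_distrib by (intro tendsto_diff lim ln_norm_const_deriv)

lemma logratio_tendsto_0: "(\<lambda>n. logratio n x) \<longlonglongrightarrow> 0"
proof -
  have "(\<lambda>n. logratio n x / \<epsilon> n * \<epsilon> n) \<longlonglongrightarrow> (s x - smean) * 0" by (intro tendsto_mult logratio_deriv eps_lim)
  then show ?thesis using eps_pos by (simp add: less_imp_neq[OF eps_pos, symmetric])
qed

text \<open>Pointwise, \<open>Q (logratio n x)\<close> divided by
  \<open>(\<epsilon> n)\<^sup>2\<close> is \<open>R (logratio n x)\<close> times the squared
  difference quotient, and the growth bound on \<open>Q\<close> provides a majorant independent of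
  \<open>n\<close>. This extracts the second-order coefficient of a one-coordinate
  expectation.\<close>

lemma integral_quadratic_limit:
  fixes Q R :: "real \<Rightarrow> complex"
  assumes [measurable]: "Q \<in> borel_measurable borel"
    and QR: "\<And>y. Q y = R y * of_real (y\<^sup>2)" and R: "isCont R 0"
    and Qb: "\<And>y. cmod (Q y) \<le> C * (y\<^sup>2 * (1 + exp y))"
  shows "integrable P (\<lambda>x. Q (logratio n x))"
    and "(\<lambda>n. (\<integral>x. Q (logratio n x) \<partial>P) / of_real ((\<epsilon> n)\<^sup>2)) \<longlonglongrightarrow> R 0 * of_real (\<integral>x. (s x - smean)\<^sup>2 \<partial>P)"
proof -
  have C: "C \<ge> 0"
  proof (rule ccontr)
    assume "\<not> ?thesis"
    then have "C * (1\<^sup>2 * (1 + exp 1)) < 0" by (intro mult_neg_pos) (auto intro: add_pos_pos)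
    then show False using order_trans[OF norm_ge_zero Qb[of 1]] by linarith
  qed
  \<comment> \<open>Convergent sequences are bounded: \<open>K1\<close> controls the shift by
    \<open>ln (norm_const n)\<close> at scale \<open>\<epsilon> n\<close>, and \<open>K2\<close> the
    division by \<open>norm_const n\<close>, both uniformly in \<open>n\<close>.\<close>
  obtain K1 where K1: "K1 > 0" "\<And>n. \<bar>ln (norm_const n) / \<epsilon> n\<bar> \<le> K1"
    using convergent_imp_Bseq[OF convergentI[OF ln_norm_const_deriv]] by (auto elim!: BseqE)
  have "(\<lambda>n. inverse (norm_const n)) \<longlonglongrightarrow> inverse 1"
    by (intro tendsto_inverse norm_const_lim) simp
  then obtain K2 where K2: "K2 > 0" "\<And>n. \<bar>inverse (norm_const n)\<bar> \<le> K2"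
    using convergent_imp_Bseq[OF convergentI] by (metis BseqE real_norm_def)
  define C' where "C' = C * ((1 + K1)\<^sup>2 * (1 + K2))"
  have C': "C' \<ge> 0" using C K1(1) K2(1) by (simp add: C'_def)
  have dom: "cmod (Q (logratio n x) / of_real ((\<epsilon> n)\<^sup>2)) \<le> C' * ((1 + W x)\<^sup>2 * (1 + E x))" for n x
  proof -
    note W_nonneg[of x] E_pos[of x] eps_pos[of n] norm_const_pos[of n]
    note nn = this
    have "\<bar>ln (norm_const n)\<bar> \<le> \<epsilon> n * K1" using K1(2)[of n] nn by (simp add: field_simps)
    then have "\<bar>logratio n x\<bar> \<le> \<epsilon> n * (W x + K1)"
      using bound[of n x] by (simp add: logratio_def algebra_simps)
    also have "\<dots> \<le> \<epsilon> n * ((1 + K1) * (1 + W x))"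
      using nn K1(1) by (intro mult_left_mono) (auto simp: algebra_simps)
    finally have "\<bar>logratio n x\<bar>\<^sup>2 \<le> (\<epsilon> n * ((1 + K1) * (1 + W x)))\<^sup>2"
      by (intro power_mono) auto
    then have 1: "(logratio n x)\<^sup>2 \<le> (\<epsilon> n)\<^sup>2 * ((1 + K1)\<^sup>2 * (1 + W x)\<^sup>2)"
      by (simp add: power_mult_distrib)
    have "exp (logratio n x) = inverse (norm_const n) * exp (\<phi> n x)"
      by (simp add: exp_logratio field_simps)
    also have "\<dots> \<le> K2 * E x"
      by (intro mult_mono order_trans[OF abs_ge_self K2(2)] exp_bound) (use K2(1) in auto)
    also have "\<dots> \<le> (1 + K2) * (1 + E x) - 1"
      using nn K2(1) by (simp add: algebra_simps)
    finally have 2: "1 + exp (logratio n x) \<le> (1 + K2) * (1 + E x)" by simp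
    have "cmod (Q (logratio n x)) \<le> C * ((logratio n x)\<^sup>2 * (1 + exp (logratio n x)))" by (rule Qb)
    also have "\<dots> \<le> C * ((\<epsilon> n)\<^sup>2 * ((1 + K1)\<^sup>2 * (1 + W x)\<^sup>2) * ((1 + K2) * (1 + E x)))"
      using C K1(1) by (intro mult_left_mono mult_mono 1 2) (auto simp: add_nonneg_nonneg)
    finally have "cmod (Q (logratio n x)) \<le> (\<epsilon> n)\<^sup>2 * (C' * ((1 + W x)\<^sup>2 * (1 + E x)))"
      unfolding C'_def by (simp only: mult_ac)
    moreover have "cmod (of_real ((\<epsilon> n)\<^sup>2)) = (\<epsilon> n)\<^sup>2" by (simp add: norm_power)
    ultimately show ?thesis using nn unfolding norm_divide by (subst pos_divide_le_eq) (auto simp: mult_ac)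
  qed
  have ne: "complex_of_real (\<epsilon> n) \<noteq> 0" for n using eps_pos[of n] by simp
  have i1: "integrable P (\<lambda>x. Q (logratio n x) / of_real ((\<epsilon> n)\<^sup>2))" for n
    by (rule integrable_dominated[OF _ dom]) measurable
  then show "integrable P (\<lambda>x. Q (logratio n x))" for n
    using integrable_mult_left[OF i1[of n], of "of_real ((\<epsilon> n)\<^sup>2)"] ne[of n] by simp
  have "(\<lambda>n. \<integral>x. Q (logratio n x) / of_real ((\<epsilon> n)\<^sup>2) \<partial>P) \<longlonglongrightarrow> (\<integral>x. R 0 * of_real ((s x - smean)\<^sup>2) \<partial>P)"
  proof (rule integral_dominated_convergence)
    show "integrable P (\<lambda>x. C' * ((1 + W x)\<^sup>2 * (1 + E x)))" using int by simp
    show "AE x in P. norm (Q (logratio n x) / of_real ((\<epsilon> n)\<^sup>2)) \<le> C' * ((1 + W x)\<^sup>2 * (1 + E x))" for n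
      using dom by simp
    show "AE x in P. (\<lambda>n. Q (logratio n x) / of_real ((\<epsilon> n)\<^sup>2)) \<longlonglongrightarrow> R 0 * of_real ((s x - smean)\<^sup>2)"
    proof (rule AE_I2)
      fix x
      have "(\<lambda>n. R (logratio n x) * of_real ((logratio n x / \<epsilon> n)\<^sup>2)) \<longlonglongrightarrow> R 0 * of_real ((s x - smean)\<^sup>2)"
        by (intro tendsto_mult tendsto_of_real tendsto_power logratio_deriv
            isCont_tendsto_compose[OF R] logratio_tendsto_0)
      then show "(\<lambda>n. Q (logratio n x) / of_real ((\<epsilon> n)\<^sup>2)) \<longlonglongrightarrow> R 0 * of_real ((s x - smean)\<^sup>2)"
        by (simp add: QR power_divide)
    qed
  qed measurable
  then show "(\<lambda>n. (\<integral>x. Q (logratio n x) \<partial>P) / of_real ((\<epsilon> n)\<^sup>2)) \<longlonglongrightarrow> R 0 * of_real (\<integral>x. (s x - smean)\<^sup>2 \<partial>P)"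
    unfolding integral_divide_zero integral_mult_right_zero integral_complex_of_real .
qed

text \<open>One factor belongs to \<open>\<phi> n\<close> under the base law, the other to
  \<open>- \<phi> n\<close> under the tilted law. Once mean-zero multiples of
  \<open>exp (logratio n x) - 1\<close> are removed, each is 1 plus a term of order
  \<open>(\<epsilon> n)\<^sup>2\<close>, so \<open>power_tendsto_exp\<close> applies. The two
  second-order coefficients coincide, and their sum is
  \<open>- (\<i> * t + t\<^sup>2)\<close>.\<close>

lemma char_limit:
  fixes D :: "nat \<Rightarrow> nat" and l t :: real
  assumes D: "filterlim D at_top sequentially" and lD: "\<And>n. real (D n) * (\<epsilon> n)\<^sup>2 = l\<^sup>2"
  defines "v \<equiv> (\<integral>x. (s x - smean)\<^sup>2 \<partial>P)"
  shows "(\<lambda>n. ((\<integral>x. iexp (t * \<phi> n x) \<partial>P) *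
      ((\<integral>x. exp (\<phi> n x) * iexp (- (t * \<phi> n x)) \<partial>P) / norm_const n)) ^ D n)
    \<longlonglongrightarrow> exp (- (\<i> * t + of_real (t\<^sup>2)) * (l\<^sup>2 * v))"
proof -
  obtain R where R: "\<And>y. cexp2 t y = R y * of_real (y\<^sup>2)" "isCont R 0" "R 0 = - (of_real (t\<^sup>2) + \<i> * t) / 2"
    using cexp2_quadratic by blast
  have [measurable]: "cexp2 t \<in> borel_measurable borel"
    unfolding cexp2_def[abs_def] by measurable
  \<comment> \<open>The density \<open>exp y\<close> of the tilted law is absorbed into the
    integrand. The same growth bound survives because
    \<open>exp y * (1 + exp (- y)) = 1 + exp y\<close>.\<close>
  define Q2 where "Q2 y = of_real (exp y) * cexp2 t (- y)" for y
  define R2 where "R2 y = of_real (exp y) * R (- y)" for y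
  have Q2m [measurable]: "Q2 \<in> borel_measurable borel"
    unfolding Q2_def[abs_def] by measurable
  have Q2b: "cmod (Q2 y) \<le> (t\<^sup>2 + \<bar>t\<bar>) * (y\<^sup>2 * (1 + exp y))" for y
  proof -
    have "cmod (Q2 y) \<le> exp y * ((t\<^sup>2 + \<bar>t\<bar>) * ((- y)\<^sup>2 * (1 + exp (- y))))"
      unfolding Q2_def norm_mult using cexp2_bound[of t "- y"] by simp
    also have "\<dots> = (t\<^sup>2 + \<bar>t\<bar>) * (y\<^sup>2 * (1 + exp y))"
      by (simp add: exp_minus field_simps)
    finally show ?thesis .
  qed
  have R2: "isCont R2 0"
  proof -
    have "isCont (\<lambda>y. R (- y)) 0" using isCont_o2[where f="uminus :: real \<Rightarrow> real" and g=R and a=0] R(2) by simp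
    then show ?thesis unfolding R2_def by (intro isCont_mult) auto
  qed
  note lim1 = integral_quadratic_limit[OF _ R(1,2) cexp2_bound]
  have Q2R2: "Q2 y = R2 y * of_real (y\<^sup>2)" for y by (simp add: Q2_def R2_def R(1))
  note lim2 = integral_quadratic_limit[OF Q2m Q2R2 R2 Q2b]
  define a1 where "a1 n = (\<integral>x. cexp2 t (logratio n x) \<partial>P)" for n
  define a2 where "a2 n = (\<integral>x. Q2 (logratio n x) \<partial>P)" for n
  have ie: "integrable P (\<lambda>x. of_real (exp (logratio n x)) :: complex)" for n
    using integrable_exp_logratio by (rule integrable_of_real)
  have ie1: "(\<integral>x. of_real (exp (logratio n x)) \<partial>P) = (1::complex)" for n
    unfolding integral_complex_of_real integral_exp_logratio by simp
  have comp0: "(\<integral>x. c * (of_real (exp (logratio n x)) - 1) \<partial>P) = 0" for n and c :: complex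
    using ie[of n] ie1[of n] by (simp add: prob_space)
  have iz: "integrable P (\<lambda>x. c * (of_real (exp (logratio n x)) - 1))" for n and c :: complex
    using ie[of n] by simp
  have 1: "1 + a1 n = (\<integral>x. iexp (t * logratio n x) \<partial>P)" for n
  proof -
    have "(\<integral>x. iexp (t * logratio n x) \<partial>P)
        = (\<integral>x. 1 + cexp2 t (logratio n x) + \<i> * t * (of_real (exp (logratio n x)) - 1) \<partial>P)"
      by (intro Bochner_Integration.integral_cong) (auto simp: cexp2_def)
    also have "\<dots> = (\<integral>x. 1 + cexp2 t (logratio n x) \<partial>P) + (\<integral>x. \<i> * t * (of_real (exp (logratio n x)) - 1) \<partial>P)"
      by (intro Bochner_Integration.integral_add Bochner_Integration.integrable_add lim1(1) iz) auto
    also have "(\<integral>x. 1 + cexp2 t (logratio n x) \<partial>P) = 1 + a1 n"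
      unfolding a1_def by (subst Bochner_Integration.integral_add) (auto intro!: lim1(1) simp: prob_space)
    finally show ?thesis unfolding comp0 by simp
  qed
  have 2: "1 + a2 n = (\<integral>x. exp (logratio n x) * iexp (- (t * logratio n x)) \<partial>P)" for n
  proof -
    \<comment> \<open>The mean-zero term has coefficient \<open>1 - \<i> * t\<close>: the 1 stems
      from the density, and \<open>- \<i> * t\<close> from the compensator at the reflected argument
      after multiplication by the density.\<close>
    have "(\<integral>x. exp (logratio n x) * iexp (- (t * logratio n x)) \<partial>P)
        = (\<integral>x. 1 + Q2 (logratio n x) + (1 - \<i> * t) * (of_real (exp (logratio n x)) - 1) \<partial>P)"
    proof (intro Bochner_Integration.integral_cong refl)
      fix x
      have "complex_of_real (exp (logratio n x)) * of_real (exp (- logratio n x)) = 1"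
        by (simp flip: of_real_mult exp_add)
      then show "exp (logratio n x) * iexp (- (t * logratio n x))
        = 1 + Q2 (logratio n x) + (1 - \<i> * t) * (of_real (exp (logratio n x)) - 1)"
        unfolding Q2_def cexp2_def by (simp add: algebra_simps)
    qed
    also have "\<dots> = (\<integral>x. 1 + Q2 (logratio n x) \<partial>P) + (\<integral>x. (1 - \<i> * t) * (of_real (exp (logratio n x)) - 1) \<partial>P)"
      by (intro Bochner_Integration.integral_add Bochner_Integration.integrable_add lim2(1) iz) auto
    also have "(\<integral>x. 1 + Q2 (logratio n x) \<partial>P) = 1 + a2 n"
      unfolding a2_def by (subst Bochner_Integration.integral_add) (auto intro!: lim2(1) simp: prob_space)
    finally show ?thesis unfolding comp0 by simp
  qed
  have le1: "cmod (1 + a1 n) \<le> 1" for n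
    unfolding 1 by (rule order_trans[OF integral_norm_bound]) (simp add: prob_space)
  have le2: "cmod (1 + a2 n) \<le> 1" for n
    unfolding 2 by (rule order_trans[OF integral_norm_bound])
      (simp add: norm_mult integral_exp_logratio)
  have scale: "(\<lambda>n. of_nat (D n) * a n) \<longlonglongrightarrow> of_real (l\<^sup>2) * L"
    if "(\<lambda>n. a n / of_real ((\<epsilon> n)\<^sup>2)) \<longlonglongrightarrow> L" for a :: "nat \<Rightarrow> complex" and L
  proof -
    have "of_real (l\<^sup>2) * (a n / of_real ((\<epsilon> n)\<^sup>2)) = of_nat (D n) * a n" for n
      unfolding lD[of n, symmetric] using eps_pos[of n] by simp
    with tendsto_mult_left[OF that, of "of_real (l\<^sup>2)"] show ?thesis by simp
  qed
  have "(\<lambda>n. (1 + a1 n) ^ D n * (1 + a2 n) ^ D n)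
      \<longlonglongrightarrow> exp (of_real (l\<^sup>2) * (R 0 * of_real v)) * exp (of_real (l\<^sup>2) * (R2 0 * of_real v))"
    unfolding a1_def a2_def v_def
    by (intro tendsto_mult power_tendsto_exp[OF D] scale lim1(2) lim2(2)
        le1[unfolded a1_def] le2[unfolded a2_def]) auto
  also have "exp (of_real (l\<^sup>2) * (R 0 * of_real v)) * exp (of_real (l\<^sup>2) * (R2 0 * of_real v))
      = exp (- (\<i> * t + of_real (t\<^sup>2)) * (l\<^sup>2 * v))"
    unfolding exp_add[symmetric] by (rule arg_cong[where f=exp]) (simp add: R2_def R(3) field_simps)
  also have "(\<lambda>n. (1 + a1 n) ^ D n * (1 + a2 n) ^ D n) = (\<lambda>n. ((\<integral>x. iexp (t * \<phi> n x) \<partial>P) *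
      ((\<integral>x. exp (\<phi> n x) * iexp (- (t * \<phi> n x)) \<partial>P) / norm_const n)) ^ D n)"
  proof
    fix n
    \<comment> \<open>The normalising constant enters the two factors through opposite phases, which
      cancel; so \<open>logratio\<close> may be replaced by \<open>\<phi>\<close>, and only the
      division by \<open>norm_const n\<close> remains.\<close>
    define c where "c = ln (norm_const n)"
    have e1: "iexp (t * logratio n x) = iexp (t * \<phi> n x) * iexp (- (t * c))" for x
      by (simp add: logratio_def c_def algebra_simps flip: exp_add)
    have e2: "exp (logratio n x) * iexp (- (t * logratio n x))
        = exp (\<phi> n x) * iexp (- (t * \<phi> n x)) * (iexp (t * c) / norm_const n)" for x
      unfolding exp_logratio by (simp add: logratio_def c_def algebra_simps flip: exp_add)
    have w: "iexp (- (t * c)) * iexp (t * c) = 1" by (simp flip: exp_add)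
    have cancel: "X * iexp (- (t * c)) * (Y * (iexp (t * c) / N)) = X * (Y / N)" for X Y N :: complex
    proof -
      have "X * iexp (- (t * c)) * (Y * (iexp (t * c) / N))
          = (iexp (- (t * c)) * iexp (t * c)) * (X * (Y / N))"
        by (simp only: mult_ac times_divide_eq_left times_divide_eq_right)
      then show ?thesis unfolding w by simp
    qed
    show "(1 + a1 n) ^ D n * (1 + a2 n) ^ D n = ((\<integral>x. iexp (t * \<phi> n x) \<partial>P) *
      ((\<integral>x. exp (\<phi> n x) * iexp (- (t * \<phi> n x)) \<partial>P) / norm_const n)) ^ D n"
      unfolding 1 2 e1 e2 power_mult_distrib[symmetric] integral_mult_left_zero cancel ..
  qed
  finally show ?thesis .
qed

end

section \<open>The law of the log acceptance ratio\<close>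

text \<open>The exponential of the sum is a product of unimodular functions of single coordinates.
  Fubini separates the two blocks, and the product formula separates the coordinates within
  each.\<close>

lemma char_product_sum:
  fixes P P' :: "real measure" and u v :: "real \<Rightarrow> real" and d :: nat and t :: real
  assumes P: "prob_space P" "sets P = sets borel" and P': "prob_space P'" "sets P' = sets borel"
    and uv: "u \<in> borel_measurable borel" "v \<in> borel_measurable borel"
  defines "\<Omega> \<equiv> PiM {..<d} (\<lambda>_. P) \<Otimes>\<^sub>M PiM {..<d} (\<lambda>_. P')"
    and "S \<equiv> (\<lambda>(x, y). (\<Sum>i<d. u (x i)) + (\<Sum>i<d. v (y i)))"
  shows "prob_space \<Omega>" and "S \<in> borel_measurable \<Omega>"
    and "char (distr \<Omega> borel S) t = (\<integral>x. iexp (t * u x) \<partial>P) ^ d * (\<integral>x. iexp (t * v x) \<partial>P') ^ d"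
proof -
  interpret P: prob_space P by fact
  interpret P': prob_space P' by fact
  interpret A: product_sigma_finite "\<lambda>_::nat. P" by standard
  interpret A': product_sigma_finite "\<lambda>_::nat. P'" by standard
  interpret PA: prob_space "PiM {..<d} (\<lambda>_. P)" by (intro prob_space_PiM P(1))
  interpret PA': prob_space "PiM {..<d} (\<lambda>_. P')" by (intro prob_space_PiM P'(1))
  interpret PP: pair_prob_space "PiM {..<d} (\<lambda>_. P)" "PiM {..<d} (\<lambda>_. P')" by standard
  show "prob_space \<Omega>" unfolding \<Omega>_def by (rule PP.prob_space_axioms)
  have um [measurable]: "u \<in> borel_measurable P" "v \<in> borel_measurable P'"
    using uv P(2) P'(2) by (auto cong: measurable_cong_sets)
  show Sm: "S \<in> borel_measurable \<Omega>"
    unfolding S_def \<Omega>_def by measurable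
  define a b where "a = (\<lambda>x. \<Prod>i<d. iexp (t * u (x i)))" and "b = (\<lambda>y. \<Prod>i<d. iexp (t * v (y i)))"
  have am [measurable]: "a \<in> borel_measurable (PiM {..<d} (\<lambda>_. P))"
      "b \<in> borel_measurable (PiM {..<d} (\<lambda>_. P'))"
    unfolding a_def b_def by measurable
  have norm_a: "cmod (a x) = 1" "cmod (b x) = 1" for x
    unfolding a_def b_def by (simp_all add: prod_norm[symmetric])
  have "char (distr \<Omega> borel S) t = (\<integral>w. iexp (t * S w) \<partial>\<Omega>)"
    unfolding char_def by (rule integral_distr[OF Sm]) simp
  also have "\<dots> = (\<integral>(x, y). a x * b y \<partial>\<Omega>)"
    by (intro Bochner_Integration.integral_cong)
       (auto simp: S_def a_def b_def exp_sum[symmetric] exp_add[symmetric] sum_distrib_left distrib_left)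
  also have "\<dots> = (\<integral>x. (\<integral>y. a x * b y \<partial>PiM {..<d} (\<lambda>_. P')) \<partial>PiM {..<d} (\<lambda>_. P))"
    unfolding \<Omega>_def
    by (subst PP.integral_fst'[symmetric])
       (auto intro!: PP.integrable_const_bound[where B=1] simp: norm_mult norm_a)
  also have "\<dots> = (\<integral>x. a x \<partial>PiM {..<d} (\<lambda>_. P)) * (\<integral>y. b y \<partial>PiM {..<d} (\<lambda>_. P'))"
    by simp
  also have "(\<integral>x. a x \<partial>PiM {..<d} (\<lambda>_. P)) = (\<integral>x. iexp (t * u x) \<partial>P) ^ d"
    unfolding a_def
    by (subst A.product_integral_prod) (auto intro!: P.integrable_const_bound[where B=1])
  also have "(\<integral>x. b x \<partial>PiM {..<d} (\<lambda>_. P')) = (\<integral>x. iexp (t * v x) \<partial>P') ^ d"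
    unfolding b_def
    by (subst A'.product_integral_prod) (auto intro!: P'.integrable_const_bound[where B=1])
  finally show "char (distr \<Omega> borel S) t = (\<integral>x. iexp (t * u x) \<partial>P) ^ d * (\<integral>x. iexp (t * v x) \<partial>P') ^ d" .
qed

text \<open>The contribution of one coordinate of \<open>x\<close> to the log acceptance ratio; a coordinate \<open>y\<close>
  at the other temperature contributes \<open>- swap_log (g y)\<close> with \<open>g\<close> the inverse rescaling.\<close>

definition swap_log :: "(real \<Rightarrow> real) \<Rightarrow> real \<Rightarrow> real \<Rightarrow> real \<Rightarrow> real \<Rightarrow> real" where
  "swap_log f \<mu> \<beta> \<beta>' x = \<beta>' * ln (f (sqrt (\<beta> / \<beta>') * (x - \<mu>) + \<mu>)) - \<beta> * ln (f x)"

lemma swap_acc_eq: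
  assumes pos: "\<And>x. f x > 0" and \<beta>: "\<beta> > 0" "\<beta>' > 0"
  shows "swap_acc f \<mu> d \<beta> \<beta>' x y = min 1 (exp ((\<Sum>i<d. swap_log f \<mu> \<beta> \<beta>' (x i))
     + (\<Sum>i<d. - swap_log f \<mu> \<beta> \<beta>' (sqrt (\<beta>' / \<beta>) * (y i - \<mu>) + \<mu>))))"
proof -
  have fd: "fd_pow f d b z = exp (\<Sum>i<d. b * ln (f (z i)))" for b z
    unfolding fd_pow_def using pos[THEN less_imp_neq] by (simp add: exp_sum powr_def)
  \<comment> \<open>The two rescalings are mutually inverse, so \<open>swap_log\<close> at the
    rescaled \<open>y i\<close> contains \<open>ln (f (y i))\<close> with factor
    \<open>\<beta>'\<close>, as the denominator of the acceptance ratio requires.\<close>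
  have inv: "sqrt (\<beta> / \<beta>') * (sqrt (\<beta>' / \<beta>) * c) = c" for c
    using \<beta> by (simp add: mult.assoc[symmetric] real_sqrt_mult[symmetric])
  show ?thesis
    unfolding swap_acc_def fd swap_g_def swap_log_def
    by (simp add: exp_add[symmetric] exp_diff[symmetric] inv sum_subtractf sum_negf)
       (simp add: algebra_simps)
qed

lemma integral_stat_measure:
  fixes u :: "real \<Rightarrow> 'b :: {banach, second_countable_topology}"
  assumes pos: "\<And>x. f x > 0" and [measurable]: "f \<in> borel_measurable borel" "u \<in> borel_measurable borel"
  shows "(\<integral>x. u x \<partial>stat_measure f b)
    = (\<integral>x. (f x powr b) *\<^sub>R u x \<partial>lborel) /\<^sub>R (\<integral>x. f x powr b \<partial>lborel)"
proof -
  have nn: "(\<integral>x. f x powr b \<partial>lborel) \<ge> 0" by (rule integral_nonneg_AE) simp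
  have "(\<integral>x. u x \<partial>stat_measure f b) = (\<integral>x. (f x powr b / (\<integral>z. f z powr b \<partial>lborel)) *\<^sub>R u x \<partial>lborel)"
    unfolding stat_measure_def using nn by (intro integral_density) auto
  also have "\<dots> = (\<integral>x. inverse (\<integral>z. f z powr b \<partial>lborel) *\<^sub>R ((f x powr b) *\<^sub>R u x) \<partial>lborel)"
    by (simp add: divide_inverse mult.commute)
  finally show ?thesis unfolding integral_scaleR_right .
qed

lemma sets_stat_measure [simp]: "sets (stat_measure f b) = sets borel"
  by (simp add: stat_measure_def)

lemma space_stat_measure [simp]: "space (stat_measure f b) = UNIV"
  by (simp add: stat_measure_def)

lemma powr_integral_pos:
  assumes pos: "\<And>x. f x > 0" and int: "integrable lborel (\<lambda>x. f x powr b)"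
  shows "(\<integral>x. f x powr b \<partial>lborel) > (0::real)"
proof -
  have "(\<integral>x. f x powr b \<partial>lborel) \<noteq> 0"
    using pos[THEN less_imp_neq] by (subst integral_nonneg_eq_0_iff_AE[OF int]) (auto simp: eventually_False ae_filter_eq_bot_iff)
  moreover have "(\<integral>x. f x powr b \<partial>lborel) \<ge> 0" by (rule integral_nonneg_AE) simp
  ultimately show ?thesis by linarith
qed

lemma prob_space_stat_measure:
  assumes pos: "\<And>x. f x > 0" and [measurable]: "f \<in> borel_measurable borel"
    and int: "integrable lborel (\<lambda>x. f x powr b)"
  shows "prob_space (stat_measure f b)"
proof
  have Z: "(\<integral>x. f x powr b \<partial>lborel) > 0" by (rule powr_integral_pos[OF pos int])
  have "emeasure (stat_measure f b) UNIV = (\<integral>\<^sup>+x. ennreal (f x powr b / (\<integral>z. f z powr b \<partial>lborel)) \<partial>lborel)"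
    unfolding stat_measure_def by (subst emeasure_density) auto
  also have "\<dots> = ennreal (\<integral>x. f x powr b / (\<integral>z. f z powr b \<partial>lborel) \<partial>lborel)"
    using int Z by (intro nn_integral_eq_integral) auto
  also have "\<dots> = 1" using Z by simp
  finally show "emeasure (stat_measure f b) (space (stat_measure f b)) = 1" by simp
qed

lemma integrable_stat_measure:
  fixes u :: "real \<Rightarrow> 'b :: {banach, second_countable_topology}"
  assumes pos: "\<And>x. f x > 0" and [measurable]: "f \<in> borel_measurable borel" "u \<in> borel_measurable borel"
    and int: "integrable lborel (\<lambda>x. (f x powr b) *\<^sub>R u x)"
  shows "integrable (stat_measure f b) u"
proof -
  have nn: "(\<integral>x. f x powr b \<partial>lborel) \<ge> 0" by (rule integral_nonneg_AE) simp
  have "integrable lborel (\<lambda>x. (f x powr b / (\<integral>z. f z powr b \<partial>lborel)) *\<^sub>R u x)"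
    by (rule Bochner_Integration.integrable_cong[THEN iffD1, OF refl _
          integrable_scaleR_right[OF int, of "inverse (\<integral>z. f z powr b \<partial>lborel)"]])
       (simp add: divide_inverse mult.commute)
  then show ?thesis
    unfolding stat_measure_def using nn by (subst integrable_density) auto
qed

text \<open>Substitute \<open>y = g x\<close>: up to normalisation, \<open>exp swap_log\<close> is the density of the pulled-back law
  at \<open>\<beta>'\<close> with respect to the law at \<open>\<beta>\<close>.\<close>

lemma integral_swap:
  fixes Q :: "real \<Rightarrow> complex" and \<mu> \<beta> \<beta>' :: real
  assumes pos: "\<And>x. f x > 0" and [measurable]: "f \<in> borel_measurable borel" "Q \<in> borel_measurable borel"
    and \<beta>: "\<beta> > 0" "\<beta>' > 0"
    and int: "integrable lborel (\<lambda>x. f x powr \<beta>)"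
  defines "\<phi> \<equiv> swap_log f \<mu> \<beta> \<beta>'"
  shows "(\<integral>y. Q (\<phi> (sqrt (\<beta>' / \<beta>) * (y - \<mu>) + \<mu>)) \<partial>stat_measure f \<beta>')
    = (\<integral>x. of_real (exp (\<phi> x)) * Q (\<phi> x) \<partial>stat_measure f \<beta>)
      / of_real (\<integral>x. exp (\<phi> x) \<partial>stat_measure f \<beta>)"
proof -
  define \<theta> where "\<theta> = sqrt (\<beta> / \<beta>')"
  have \<theta>: "\<theta> > 0" using \<beta> by (simp add: \<theta>_def)
  have inv: "sqrt (\<beta>' / \<beta>) * (\<theta> * c) = c" for c
    using \<beta> by (simp add: \<theta>_def mult.assoc[symmetric] real_sqrt_mult[symmetric])
  have [measurable]: "\<phi> \<in> borel_measurable borel"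
    unfolding \<phi>_def swap_log_def[abs_def] by measurable
  \<comment> \<open>The rescaling is written as
    \<open>\<mu> * (1 - \<theta>) + \<theta> * x\<close>, the affine form of the change of variables
    on the line.\<close>
  have lr: "f (\<mu> * (1 - \<theta>) + \<theta> * x) powr \<beta>' = f x powr \<beta> * exp (\<phi> x)" for x
    using pos[of x] pos[of "\<mu> * (1 - \<theta>) + \<theta> * x"]
    by (simp add: powr_def \<phi>_def swap_log_def \<theta>_def algebra_simps flip: exp_add)
  have arg: "sqrt (\<beta>' / \<beta>) * (\<mu> * (1 - \<theta>) + \<theta> * x - \<mu>) + \<mu> = x" for x
  proof -
    have "\<mu> * (1 - \<theta>) + \<theta> * x - \<mu> = \<theta> * (x - \<mu>)" by (simp add: algebra_simps)
    then show ?thesis by (simp add: inv)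
  qed
  define Z where "Z = (\<integral>x. f x powr \<beta> \<partial>lborel)"
  have Z: "Z > 0" unfolding Z_def by (rule powr_integral_pos[OF pos int])
  \<comment> \<open>The integral and its normalising constant both acquire the Jacobian
    \<open>\<theta>\<close>, which cancels in the quotient.\<close>
  have num: "(\<integral>y. (f y powr \<beta>') *\<^sub>R Q (\<phi> (sqrt (\<beta>' / \<beta>) * (y - \<mu>) + \<mu>)) \<partial>lborel)
      = \<theta> *\<^sub>R (\<integral>x. (f x powr \<beta>) *\<^sub>R (of_real (exp (\<phi> x)) * Q (\<phi> x)) \<partial>lborel)"
    by (subst lborel_integral_real_affine[where c=\<theta> and t="\<mu> * (1 - \<theta>)"], use \<theta> in simp, simp only: lr arg)
      (use \<theta> in \<open>simp add: scaleR_conv_of_real mult.assoc\<close>)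
  have den: "(\<integral>y. f y powr \<beta>' \<partial>lborel) = \<theta> * (\<integral>x. (f x powr \<beta>) * exp (\<phi> x) \<partial>lborel)"
    by (subst lborel_integral_real_affine[where c=\<theta> and t="\<mu> * (1 - \<theta>)"], use \<theta> in simp, simp only: lr)
      (use \<theta> in simp)
  have e1: "(\<integral>y. Q (\<phi> (sqrt (\<beta>' / \<beta>) * (y - \<mu>) + \<mu>)) \<partial>stat_measure f \<beta>')
      = (\<theta> *\<^sub>R (\<integral>x. (f x powr \<beta>) *\<^sub>R (of_real (exp (\<phi> x)) * Q (\<phi> x)) \<partial>lborel))
        /\<^sub>R (\<theta> * (\<integral>x. (f x powr \<beta>) * exp (\<phi> x) \<partial>lborel))"
    unfolding num[symmetric] den[symmetric] by (rule integral_stat_measure[OF pos]) measurable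
  have e2: "(\<integral>x. of_real (exp (\<phi> x)) * Q (\<phi> x) \<partial>stat_measure f \<beta>)
      = (\<integral>x. (f x powr \<beta>) *\<^sub>R (of_real (exp (\<phi> x)) * Q (\<phi> x)) \<partial>lborel) /\<^sub>R Z"
    unfolding Z_def by (rule integral_stat_measure[OF pos]) measurable
  have e3: "(\<integral>x. exp (\<phi> x) \<partial>stat_measure f \<beta>) = (\<integral>x. (f x powr \<beta>) * exp (\<phi> x) \<partial>lborel) / Z"
    unfolding Z_def by (subst integral_stat_measure[OF pos]) (auto simp: field_simps)
  show ?thesis
    unfolding e1 e2 e3 using Z \<theta> by (simp add: scaleR_conv_of_real divide_inverse mult_ac)
qed

section \<open>Polynomial growth and rapid decay\<close>

text \<open>The base \<open>1 + \<bar>x\<bar>\<close> is at least 1, so bounds with different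
  exponents are comparable and sums need no case distinction near 0.\<close>

definition pbdd :: "(real \<Rightarrow> real) \<Rightarrow> bool" where
  "pbdd u \<longleftrightarrow> (\<exists>C n. \<forall>x. \<bar>u x\<bar> \<le> C * (1 + \<bar>x\<bar>) ^ n)"

lemma pbddI: "(\<And>x. \<bar>u x\<bar> \<le> C * (1 + \<bar>x\<bar>) ^ n) \<Longrightarrow> pbdd u"
  unfolding pbdd_def by blast

lemma pbddE:
  assumes "pbdd u"
  obtains C n where "C > 0" "\<And>x. \<bar>u x\<bar> \<le> C * (1 + \<bar>x\<bar>) ^ n"
proof -
  obtain C n where C: "\<And>x. \<bar>u x\<bar> \<le> C * (1 + \<bar>x\<bar>) ^ n" using assms unfolding pbdd_def by blast
  show thesis
  proof (rule that[of "\<bar>C\<bar> + 1" n])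
    fix x
    have "C * (1 + \<bar>x\<bar>) ^ n \<le> (\<bar>C\<bar> + 1) * (1 + \<bar>x\<bar>) ^ n" by (intro mult_right_mono) auto
    with C[of x] show "\<bar>u x\<bar> \<le> (\<bar>C\<bar> + 1) * (1 + \<bar>x\<bar>) ^ n" by linarith
  qed simp
qed

lemma pbdd_const: "pbdd (\<lambda>x. c)"
  by (rule pbddI[where C="\<bar>c\<bar>" and n=0]) simp

lemma pbdd_id: "pbdd (\<lambda>x. x)"
  by (rule pbddI[where C=1 and n=1]) simp

lemma pbdd_power_abs: "pbdd (\<lambda>x. (1 + \<bar>x\<bar>) ^ n)"
  by (rule pbddI[where C=1 and n=n]) simp

lemma pbdd_mult:
  assumes "pbdd u" "pbdd v"
  shows "pbdd (\<lambda>x. u x * v x)"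
proof -
  obtain C m where C: "C > 0" "\<And>x. \<bar>u x\<bar> \<le> C * (1 + \<bar>x\<bar>) ^ m" using assms(1) by (rule pbddE) blast
  obtain D n where D: "D > 0" "\<And>x. \<bar>v x\<bar> \<le> D * (1 + \<bar>x\<bar>) ^ n" using assms(2) by (rule pbddE) blast
  show ?thesis
  proof (rule pbddI)
    fix x
    have "\<bar>u x * v x\<bar> \<le> (C * (1 + \<bar>x\<bar>) ^ m) * (D * (1 + \<bar>x\<bar>) ^ n)"
      unfolding abs_mult using C D by (intro mult_mono) (auto intro!: mult_nonneg_nonneg)
    then show "\<bar>u x * v x\<bar> \<le> (C * D) * (1 + \<bar>x\<bar>) ^ (m + n)" by (simp add: power_add mult_ac)
  qed
qed

lemma pbdd_add:
  assumes "pbdd u" "pbdd v"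
  shows "pbdd (\<lambda>x. u x + v x)"
proof -
  obtain C m where C: "C > 0" "\<And>x. \<bar>u x\<bar> \<le> C * (1 + \<bar>x\<bar>) ^ m" using assms(1) by (rule pbddE) blast
  obtain D n where D: "D > 0" "\<And>x. \<bar>v x\<bar> \<le> D * (1 + \<bar>x\<bar>) ^ n" using assms(2) by (rule pbddE) blast
  show ?thesis
  proof (rule pbddI)
    fix x :: real
    have "C * (1 + \<bar>x\<bar>) ^ m \<le> C * (1 + \<bar>x\<bar>) ^ max m n" "D * (1 + \<bar>x\<bar>) ^ n \<le> D * (1 + \<bar>x\<bar>) ^ max m n"
      using C(1) D(1) by (auto intro!: mult_left_mono power_increasing)
    then show "\<bar>u x + v x\<bar> \<le> (C + D) * (1 + \<bar>x\<bar>) ^ max m n"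
      using C(2)[of x] D(2)[of x] abs_triangle_ineq[of "u x" "v x"] unfolding distrib_right by linarith
  qed
qed

lemma pbdd_diff: "pbdd u \<Longrightarrow> pbdd v \<Longrightarrow> pbdd (\<lambda>x. u x - v x)"
  using pbdd_add[of u "\<lambda>x. - 1 * v x"] pbdd_mult[OF pbdd_const[of "-1"], of v] by simp

lemma pbdd_power: "pbdd u \<Longrightarrow> pbdd (\<lambda>x. u x ^ n)"
  by (induction n) (auto intro: pbdd_const pbdd_mult)

lemmas pbdd_intros = pbdd_const pbdd_id pbdd_mult pbdd_add pbdd_diff pbdd_power pbdd_power_abs

text \<open>The mean value inequality on the ball of radius \<open>\<bar>x\<bar>\<close> costs one
  degree. Repeated use passes from the bounded fourth derivative of the log-density down to the
  log-density itself.\<close>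

lemma pbdd_antideriv:
  assumes d: "\<And>x. (u has_real_derivative u' x) (at x)" and "pbdd u'"
  shows "pbdd u"
proof -
  obtain C n where C: "C > 0" "\<And>x. \<bar>u' x\<bar> \<le> C * (1 + \<bar>x\<bar>) ^ n" using assms(2) by (rule pbddE) blast
  show ?thesis
  proof (rule pbddI)
    fix x :: real
    have "\<bar>u x - u 0\<bar> \<le> (C * (1 + \<bar>x\<bar>) ^ n) * \<bar>x - 0\<bar>"
      unfolding real_norm_def[symmetric]
    proof (rule field_differentiable_bound[where S="cball 0 \<bar>x\<bar>" and f'=u'])
      fix y :: real assume "y \<in> cball 0 \<bar>x\<bar>"
      then have "C * (1 + \<bar>y\<bar>) ^ n \<le> C * (1 + \<bar>x\<bar>) ^ n"
        using C(1) by (intro mult_left_mono power_mono) auto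
      then show "norm (u' y) \<le> C * (1 + norm x) ^ n" using C(2)[of y] by simp
    qed (auto intro: has_field_derivative_at_within d)
    moreover have "\<bar>u 0\<bar> * 1 \<le> \<bar>u 0\<bar> * (1 + \<bar>x\<bar>) ^ Suc n"
      by (intro mult_left_mono one_le_power) auto
    moreover have "C * (1 + \<bar>x\<bar>) ^ n * \<bar>x\<bar> \<le> C * (1 + \<bar>x\<bar>) ^ n * (1 + \<bar>x\<bar>)"
      using C(1) by (intro mult_left_mono) auto
    moreover have "\<bar>u x\<bar> \<le> \<bar>u x - u 0\<bar> + \<bar>u 0\<bar>" by linarith
    ultimately show "\<bar>u x\<bar> \<le> (\<bar>u 0\<bar> + C) * (1 + \<bar>x\<bar>) ^ Suc n"
      by (simp add: algebra_simps)
  qed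
qed

section \<open>Rapid decay, integration on the line, and growth under regular variation\<close>

definition rapid :: "(real \<Rightarrow> real) \<Rightarrow> bool" where
  "rapid g \<longleftrightarrow> (\<forall>x. g x \<ge> 0) \<and> (\<forall>n. \<exists>C. \<forall>x. (1 + \<bar>x\<bar>) ^ n * g x \<le> C)"

lemma pbdd_rapid_bound:
  assumes "rapid g" "pbdd u"
  obtains C where "C > 0" "\<And>x. \<bar>u x * g x\<bar> \<le> C * inverse (1 + x\<^sup>2)"
proof -
  obtain C n where C: "C > 0" "\<And>x. \<bar>u x\<bar> \<le> C * (1 + \<bar>x\<bar>) ^ n" using assms(2) by (rule pbddE) blast
  \<comment> \<open>Two powers more than the growth of \<open>u\<close> leave the factor
    \<open>inverse (1 + x\<^sup>2)\<close>, which is integrable and vanishes at infinity.\<close>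
  obtain B where B: "\<And>x. (1 + \<bar>x\<bar>) ^ (n + 2) * g x \<le> B" using assms(1) unfolding rapid_def by blast
  have g: "g x \<ge> 0" for x using assms(1) unfolding rapid_def by blast
  have "\<bar>u x * g x\<bar> \<le> (C * \<bar>B\<bar> + 1) * inverse (1 + x\<^sup>2)" for x
  proof -
    have "\<bar>u x * g x\<bar> * (1 + x\<^sup>2) \<le> (C * (1 + \<bar>x\<bar>) ^ n * g x) * (1 + \<bar>x\<bar>)\<^sup>2"
      unfolding abs_mult using C g[of x]
      by (intro mult_mono) (auto intro!: mult_nonneg_nonneg simp: power2_eq_square algebra_simps abs_mult_self_eq)
    also have "\<dots> = C * ((1 + \<bar>x\<bar>) ^ (n + 2) * g x)" by (simp add: power_add mult_ac power2_eq_square)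
    also have "\<dots> \<le> C * \<bar>B\<bar>" using C(1) B[of x] by (intro mult_left_mono) auto
    finally have "\<bar>u x * g x\<bar> * (1 + x\<^sup>2) \<le> C * \<bar>B\<bar> + 1" by simp
    moreover have "1 + x\<^sup>2 > 0" by (simp add: add_pos_nonneg)
    ultimately show ?thesis by (simp add: field_simps)
  qed
  moreover have "C * \<bar>B\<bar> + 1 > 0" using C(1) by (simp add: add_nonneg_pos)
  ultimately show thesis using that by blast
qed

lemma integrable_pbdd_rapid:
  assumes "rapid g" "pbdd u" and [measurable]: "g \<in> borel_measurable borel" "u \<in> borel_measurable borel"
  shows "integrable lborel (\<lambda>x. u x * g x)"
proof -
  obtain C where C: "C > 0" "\<And>x. \<bar>u x * g x\<bar> \<le> C * inverse (1 + x\<^sup>2)"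
    using pbdd_rapid_bound[OF assms(1,2)] by blast
  have "integrable lborel (\<lambda>x::real. inverse (1 + x\<^sup>2))"
    using integrable_inverse_1_plus_square by (simp add: set_integrable_def)
  then have "integrable lborel (\<lambda>x. C * inverse (1 + x\<^sup>2))" by simp
  then show ?thesis
    by (rule Bochner_Integration.integrable_bound) (auto intro: order_trans[OF C(2) abs_ge_self])
qed

lemma pbdd_rapid_tendsto_0:
  assumes "rapid g" "pbdd u"
  shows "((\<lambda>x. u x * g x) \<longlongrightarrow> 0) at_top" "((\<lambda>x. u x * g x) \<longlongrightarrow> 0) at_bot"
proof -
  obtain C where C: "C > 0" "\<And>x. \<bar>u x * g x\<bar> \<le> C * inverse (1 + x\<^sup>2)"
    using pbdd_rapid_bound[OF assms] by blast
  have *: "((\<lambda>x. C * inverse (1 + x\<^sup>2)) \<longlongrightarrow> 0) at_top" "((\<lambda>x. C * inverse (1 + x\<^sup>2)) \<longlongrightarrow> 0) at_bot"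
    by real_asymp+
  show "((\<lambda>x. u x * g x) \<longlongrightarrow> 0) at_top" "((\<lambda>x. u x * g x) \<longlongrightarrow> 0) at_bot"
    by (rule Lim_null_comparison[rotated, OF *(1)]; simp add: C(2))
       (rule Lim_null_comparison[rotated, OF *(2)]; simp add: C(2))
qed

lemma integral_deriv_eq_0:
  fixes F F' :: "real \<Rightarrow> real"
  assumes d: "\<And>x. (F has_real_derivative F' x) (at x)" and c: "\<And>x. isCont F' x"
    and i: "integrable lborel F'"
    and l: "(F \<longlongrightarrow> 0) at_top" "(F \<longlongrightarrow> 0) at_bot"
  shows "(\<integral>x. F' x \<partial>lborel) = 0"
proof -
  have "(LBINT x=-\<infinity>..\<infinity>. F' x) = 0 - 0"
    by (rule interval_integral_FTC_integrable[where F=F])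
       (use l i in \<open>auto simp: ereal_tendsto_simps set_integrable_def c
          d[unfolded has_real_derivative_iff_has_vector_derivative]\<close>)
  then show ?thesis by (simp add: interval_lebesgue_integral_def set_lebesgue_integral_def)
qed

text \<open>Each doubling of the argument multiplies \<open>H\<close> by at least
  \<open>2 powr \<delta>\<close>, which gives power growth along dyadic multiples; monotonicity
  fills the gaps between them.\<close>

lemma regvar_growth:
  fixes H :: "real \<Rightarrow> real"
  assumes mono: "\<And>x y. T \<le> x \<Longrightarrow> x \<le> y \<Longrightarrow> H x \<le> H y"
    and ratio: "\<And>t. T \<le> t \<Longrightarrow> H (t * 2) / H t \<ge> 2 powr \<delta>"
    and T: "T > 0" and \<delta>: "\<delta> > 0"
  obtains c where "c > 0" "\<And>t. T \<le> t \<Longrightarrow> c * t powr \<delta> \<le> H t"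
proof -
  have \<rho>: "2 powr \<delta> > (1::real)" using powr_less_mono[of 0 \<delta> 2] \<delta> by simp
  have pos: "H t > 0" if "T \<le> t" for t
  proof (rule ccontr)
    assume n: "\<not> H t > 0"
    have r: "H (t * 2) / H t \<ge> 2 powr \<delta>" by (rule ratio) fact
    \<comment> \<open>For \<open>H t = 0\<close> the quotient would be 0 by convention, below
      \<open>2 powr \<delta>\<close>. A negative value is excluded next, since doubling would then
      push \<open>H\<close> further down against monotonicity.\<close>
    then have "H t \<noteq> 0" using \<rho> by (intro notI) simp
    with n have neg: "H t < 0" by simp
    have "H (t * 2) \<le> 2 powr \<delta> * H t"
      using r neg by (simp add: neg_le_divide_eq)
    also have "\<dots> < 1 * H t" using \<rho> neg by (intro mult_strict_right_mono_neg)
    finally show False using mono[of t "t * 2"] that T by simp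
  qed
  have double: "2 powr \<delta> * H t \<le> H (t * 2)" if "T \<le> t" for t
    using ratio[OF that] pos[OF that] by (simp add: field_simps)
  \<comment> \<open>With this \<open>c\<close> the bound at \<open>2 * T\<close> is exactly
    \<open>H T\<close>, so it holds on all of \<open>[T, 2 * T]\<close>, the base case of the dyadic
    induction.\<close>
  define c where "c = H T / (2 * T) powr \<delta>"
  have c: "c > 0" using pos[of T] T by (simp add: c_def)
  have main: "c * t powr \<delta> \<le> H t" if "T \<le> t" "t \<le> 2 ^ Suc n * T" for n t
    using that
  proof (induction n arbitrary: t)
    case 0
    have "t powr \<delta> \<le> (2 * T) powr \<delta>" using 0 T \<delta> by (intro powr_mono2) auto
    then have "c * t powr \<delta> \<le> c * (2 * T) powr \<delta>" using c by (intro mult_left_mono) auto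
    also have "\<dots> = H T" using T by (simp add: c_def)
    also have "\<dots> \<le> H t" using 0 by (intro mono) auto
    finally show ?case .
  next
    case (Suc n)
    show ?case
    proof (cases "t \<le> 2 ^ Suc n * T")
      case True
      then show ?thesis using Suc by blast
    next
      case False
      have "1 * T \<le> 2 ^ n * T" using T by (intro mult_right_mono) auto
      with False have t: "T \<le> t / 2" by simp
      have "c * t powr \<delta> = 2 powr \<delta> * (c * (t / 2) powr \<delta>)"
        using t T by (simp add: powr_divide)
      also have "\<dots> \<le> 2 powr \<delta> * H (t / 2)"
        using Suc t by (intro mult_left_mono Suc.IH) auto
      also have "\<dots> \<le> H t" using double[OF t] by simp
      finally show ?thesis .
    qed
  qed
  show thesis
  proof (rule that[OF c])
    fix t assume t: "T \<le> t"
    obtain n :: nat where "t / T < 2 ^ n" using real_arch_pow[of 2 "t / T"] by auto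
    then have "t < 2 ^ n * T" using T by (simp add: field_simps)
    also have "\<dots> \<le> 2 ^ Suc n * T" using T by simp
    finally show "c * t powr \<delta> \<le> H t" using main[OF t, of n] by simp
  qed
qed

lemma power_times_exp_powr_tendsto_0:
  assumes "k > 0" "\<delta> > 0"
  shows "((\<lambda>x::real. (1 + x) ^ n * exp (- k * x powr \<delta>)) \<longlongrightarrow> 0) at_top"
  using assms by real_asymp

lemma rapid_of_tails:
  fixes g :: "real \<Rightarrow> real"
  assumes g: "\<And>x. 0 \<le> g x" "\<And>x. g x \<le> B"
    and k: "k > 0" "\<delta> > 0" and tail: "\<And>x. T \<le> \<bar>x\<bar> \<Longrightarrow> g x \<le> exp (- k * \<bar>x\<bar> powr \<delta>)"
  shows "rapid g"
  unfolding rapid_def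
proof (intro conjI allI g(1))
  fix n :: nat
  have "\<forall>\<^sub>F x :: real in at_top. (1 + x) ^ n * exp (- k * x powr \<delta>) < 1"
    by (rule order_tendstoD(2)[OF power_times_exp_powr_tendsto_0[OF k]]) simp
  then obtain T' :: real where T': "\<And>x. T' \<le> x \<Longrightarrow> (1 + x) ^ n * exp (- k * x powr \<delta>) < 1"
    unfolding eventually_at_top_linorder by blast
  define T2 where "T2 = max (max T T') 0"
  have "(1 + \<bar>x\<bar>) ^ n * g x \<le> (1 + T2) ^ n * B + 1" for x
  proof (cases "T2 \<le> \<bar>x\<bar>")
    case True
    have "(1 + \<bar>x\<bar>) ^ n * g x \<le> (1 + \<bar>x\<bar>) ^ n * exp (- k * \<bar>x\<bar> powr \<delta>)"
      using True by (intro mult_left_mono tail) (auto simp: T2_def)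
    also have "\<dots> \<le> 1" using T'[of "\<bar>x\<bar>"] True by (simp add: T2_def)
    also have "\<dots> \<le> (1 + T2) ^ n * B + 1"
      using order_trans[OF g(1)[of 0] g(2)[of 0]] by (simp add: T2_def)
    finally show ?thesis .
  next
    case False
    then have "(1 + \<bar>x\<bar>) ^ n * g x \<le> (1 + T2) ^ n * B"
      using g by (intro mult_mono power_mono) (auto simp: T2_def)
    then show ?thesis by simp
  qed
  then show "\<exists>C. \<forall>x. (1 + \<bar>x\<bar>) ^ n * g x \<le> C" by blast
qed

text \<open>If \<open>y\<close> is the midpoint of \<open>x\<close> and \<open>\<mu>\<close>, then
  \<open>1 + \<bar>x\<bar>\<close> is at most a constant times \<open>1 + \<bar>y\<bar>\<close>. The
  majorant of the rescaled density is evaluated at this midpoint.\<close>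

lemma rapid_rescale:
  assumes "rapid g"
  shows "rapid (\<lambda>x. g ((x + \<mu>) / 2))"
  unfolding rapid_def
proof (intro conjI allI)
  have g: "g x \<ge> 0" for x using assms unfolding rapid_def by blast
  show "g ((x + \<mu>) / 2) \<ge> 0" for x by (rule g)
  fix n :: nat
  obtain C where C: "\<And>x. (1 + \<bar>x\<bar>) ^ n * g x \<le> C" using assms unfolding rapid_def by blast
  have "(1 + \<bar>x\<bar>) ^ n * g ((x + \<mu>) / 2) \<le> (2 + \<bar>\<mu>\<bar>) ^ n * C" for x
  proof -
    define y where "y = (x + \<mu>) / 2"
    have "\<bar>x\<bar> = \<bar>2 * y - \<mu>\<bar>" by (simp add: y_def add_divide_distrib)
    then have "1 + \<bar>x\<bar> \<le> 1 + 2 * \<bar>y\<bar> + \<bar>\<mu>\<bar>" by linarith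
    also have "\<dots> \<le> (2 + \<bar>\<mu>\<bar>) * (1 + \<bar>y\<bar>)" by (simp add: algebra_simps)
    finally have "(1 + \<bar>x\<bar>) ^ n \<le> ((2 + \<bar>\<mu>\<bar>) * (1 + \<bar>y\<bar>)) ^ n" by (intro power_mono) auto
    then have "(1 + \<bar>x\<bar>) ^ n * g y \<le> ((2 + \<bar>\<mu>\<bar>) * (1 + \<bar>y\<bar>)) ^ n * g y" using g by (intro mult_right_mono)
    also have "\<dots> = (2 + \<bar>\<mu>\<bar>) ^ n * ((1 + \<bar>y\<bar>) ^ n * g y)" by (simp add: power_mult_distrib)
    also have "\<dots> \<le> (2 + \<bar>\<mu>\<bar>) ^ n * C" using C by (intro mult_left_mono) auto
    finally show ?thesis by (simp add: y_def)
  qed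
  then show "\<exists>C. \<forall>x. (1 + \<bar>x\<bar>) ^ n * g ((x + \<mu>) / 2) \<le> C" by blast
qed

text \<open>The quotients \<open>a k\<close> of the derivatives of \<open>f\<close> by
  \<open>f\<close> satisfy \<open>a k' = a (k + 1) - a k * a 1\<close>. This closed recursion
  expresses the derivatives of the logarithm as polynomials in the \<open>a k\<close>.\<close>

lemma C4_ln_derivatives:
  assumes pos: "\<And>x. f x > 0" and "C4 f"
  obtains h1 h2 h3 h4 where
    "\<And>x. (hfun f has_real_derivative h1 x) (at x)" "\<And>x. (h1 has_real_derivative h2 x) (at x)"
    "\<And>x. (h2 has_real_derivative h3 x) (at x)" "\<And>x. (h3 has_real_derivative h4 x) (at x)"
proof -
  obtain D :: "nat \<Rightarrow> real \<Rightarrow> real" where D: "D 0 = f" "\<And>k x. k < 4 \<Longrightarrow> (D k has_real_derivative D (Suc k) x) (at x)"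
    using assms(2) unfolding C4_def by blast
  define a where "a k x = D k x / f x" for k x
  have da: "(a k has_real_derivative a (Suc k) x - a k x * a 1 x) (at x)" if "k < 4" for k x
    using DERIV_divide[OF D(2)[OF that] D(2)[of 0, unfolded D(1)]] pos[of x]
    unfolding a_def by (simp add: field_simps)
  have d0: "(hfun f has_real_derivative a 1 x) (at x)" for x
    using DERIV_chain2[OF DERIV_ln[OF pos] D(2)[of 0, unfolded D(1)]]
    by (simp add: hfun_def[abs_def] a_def field_simps)
  have d1: "(a 1 has_real_derivative a 2 x - a 1 x ^ 2) (at x)" for x
    using da[of 1 x] by (simp add: power2_eq_square numeral_2_eq_2)
  have d2: "((\<lambda>x. a 2 x - a 1 x ^ 2) has_real_derivative (a 3 x - 3 * a 1 x * a 2 x + 2 * a 1 x ^ 3)) (at x)" for x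
    by (rule DERIV_cong, rule DERIV_diff[OF da[of 2] DERIV_power[OF d1, where n=2]])
       (simp_all add: numeral_3_eq_3 numeral_2_eq_2 algebra_simps)
  have d3: "((\<lambda>x. a 3 x - 3 * a 1 x * a 2 x + 2 * a 1 x ^ 3) has_real_derivative
     (a 4 x - a 3 x * a 1 x - (3 * (a 2 x - a 1 x ^ 2) * a 2 x + (a 3 x - a 2 x * a 1 x) * (3 * a 1 x))
      + 2 * (3 * ((a 2 x - a 1 x ^ 2) * a 1 x ^ 2)))) (at x)" for x
    using DERIV_add[OF DERIV_diff[OF da[of 3 x] DERIV_mult[OF DERIV_cmult[OF d1, of 3] da[of 2 x]]]
        DERIV_cmult[OF DERIV_power[OF d1[of x], where n=3], of 2]]
    by (simp add: numeral_eq_Suc)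
  show thesis by (rule that[OF d0 d1 d2 d3])
qed

lemma hfun_deriv4:
  assumes d: "\<And>x. (u has_real_derivative h1 x) (at x)" "\<And>x. (h1 has_real_derivative h2 x) (at x)"
    "\<And>x. (h2 has_real_derivative h3 x) (at x)" "\<And>x. (h3 has_real_derivative h4 x) (at x)"
  shows "deriv u = h1" "deriv h1 = h2" "(deriv ^^ 4) u = h4"
proof -
  show 1: "deriv u = h1" "deriv h1 = h2"
    using d by (auto intro!: ext DERIV_imp_deriv)
  have "deriv h2 = h3" "deriv h3 = h4"
    using d by (auto intro!: ext DERIV_imp_deriv)
  with 1 show "(deriv ^^ 4) u = h4" by (simp add: numeral_eq_Suc)
qed

section \<open>Regularly varying targets\<close>

locale swap_target =
  fixes f H :: "real \<Rightarrow> real" and \<mu> \<alpha> M \<beta> :: real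
  assumes pos: "\<And>x. f x > 0"
    and smooth: "C4 f"
    and unimodal_left: "\<And>x y. x \<le> y \<Longrightarrow> y \<le> \<mu> \<Longrightarrow> f x \<le> f y"
    and unimodal_right: "\<And>x y. \<mu> \<le> x \<Longrightarrow> x \<le> y \<Longrightarrow> f y \<le> f x"
    and fH: "\<And>x. f x = exp (- H x)"
    and alpha_pos: "\<alpha> > 0"
    and regvar: "\<And>x. x > 0 \<Longrightarrow> ((\<lambda>t. H (t * x) / H t) \<longlongrightarrow> x powr \<alpha>) at_infinity"
    and bound4: "\<And>z. \<bar>(deriv ^^ 4) (hfun f) z\<bar> < M"
    and beta_pos: "\<beta> > 0"
begin

abbreviation "h \<equiv> hfun f"
abbreviation "h1 \<equiv> deriv (hfun f)"
abbreviation "h2 \<equiv> deriv (deriv (hfun f))"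
abbreviation "k \<equiv> kfun f \<mu>"
abbreviation "r \<equiv> rfun f \<mu>"
abbreviation "P \<equiv> stat_measure f \<beta>"

lemma h_derivs:
  shows DERIV_h: "(h has_real_derivative h1 x) (at x)"
    and DERIV_h1: "(h1 has_real_derivative h2 x) (at x)"
    and isCont_h2: "isCont h2 x"
    and pbdd_h: "pbdd h" and pbdd_h1: "pbdd h1" and pbdd_h2: "pbdd h2"
proof -
  obtain g1 g2 g3 g4 where g: "\<And>x. (h has_real_derivative g1 x) (at x)" "\<And>x. (g1 has_real_derivative g2 x) (at x)"
    "\<And>x. (g2 has_real_derivative g3 x) (at x)" "\<And>x. (g3 has_real_derivative g4 x) (at x)"
    using C4_ln_derivatives[OF pos smooth] by blast
  note eqs = hfun_deriv4[OF g]
  have "pbdd g4" using bound4 unfolding eqs(3) by (intro pbddI[where C=M and n=0]) (simp add: less_imp_le)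
  then have "pbdd g3" by (rule pbdd_antideriv[OF g(4)])
  then have p2: "pbdd g2" by (rule pbdd_antideriv[OF g(3)])
  then have p1: "pbdd g1" by (rule pbdd_antideriv[OF g(2)])
  then have p0: "pbdd h" by (rule pbdd_antideriv[OF g(1)])
  show "(h has_real_derivative h1 x) (at x)" "(h1 has_real_derivative h2 x) (at x)"
    "isCont h2 x" "pbdd h" "pbdd h1" "pbdd h2"
    unfolding eqs(1,2) using g p0 p1 p2 DERIV_isCont[OF g(3)] by auto
qed

lemma f_eq: "f x = exp (h x)"
  using pos by (simp add: hfun_def)

lemma DERIV_f: "(f has_real_derivative f x * h1 x) (at x)"
proof -
  have "((\<lambda>x. exp (h x)) has_real_derivative exp (h x) * h1 x) (at x)"
    by (rule DERIV_fun_exp[OF DERIV_h])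
  then show ?thesis using f_eq by (simp add: f_eq[abs_def, symmetric])
qed

lemma continuous:
  shows cont_f: "isCont f x" and cont_h: "isCont h x" and cont_h1: "isCont h1 x"
  using DERIV_f DERIV_h DERIV_h1 by (blast intro: DERIV_isCont)+

lemma borel_f [measurable]: "f \<in> borel_measurable borel"
  and borel_h [measurable]: "h \<in> borel_measurable borel"
  and borel_h1 [measurable]: "h1 \<in> borel_measurable borel"
  and borel_h2 [measurable]: "h2 \<in> borel_measurable borel"
  using cont_f cont_h cont_h1 isCont_h2
  by (auto intro!: borel_measurable_continuous_onI continuous_at_imp_continuous_on)

lemma borel_k [measurable]: "k \<in> borel_measurable borel"
  unfolding kfun_def[abs_def] by measurable

lemma borel_r [measurable]: "r \<in> borel_measurable borel"
  unfolding rfun_def[abs_def] by measurable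

lemma pbdd_k: "pbdd k"
  unfolding kfun_def[abs_def] by (intro pbdd_intros pbdd_h1)

lemma pbdd_r: "pbdd r"
  unfolding rfun_def[abs_def] by (intro pbdd_intros pbdd_h2)

lemma f_le: "f x \<le> f \<mu>"
  using unimodal_left[of x \<mu>] unimodal_right[of \<mu> x] by (cases "x \<le> \<mu>") auto

lemma H_growth:
  obtains c \<delta> T where "c > 0" "\<delta> > 0" "\<And>x. T \<le> \<bar>x\<bar> \<Longrightarrow> c * \<bar>x\<bar> powr \<delta> \<le> H x"
proof -
  \<comment> \<open>Halving the index leaves strict room below the limit
    \<open>2 powr \<alpha>\<close>, so the doubling ratio eventually exceeds
    \<open>2 powr \<delta>\<close> in both tails.\<close>
  define \<delta> where "\<delta> = \<alpha> / 2"
  have \<delta>: "\<delta> > 0" "\<delta> < \<alpha>" using alpha_pos by (auto simp: \<delta>_def)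
  then have "2 powr \<delta> < (2 powr \<alpha> :: real)" by simp
  from order_tendstoD(1)[OF regvar[of 2] this]
  obtain b where b: "\<And>t. b \<le> \<bar>t\<bar> \<Longrightarrow> 2 powr \<delta> < H (t * 2) / H t"
    unfolding eventually_at_infinity by auto
  \<comment> \<open>Beyond \<open>\<bar>\<mu>\<bar>\<close> unimodality makes \<open>H\<close>
    monotone on each side; beyond \<open>b\<close> the doubling bound holds, and the 1 keeps
    \<open>T\<close> positive.\<close>
  define T where "T = max (max b 1) \<bar>\<mu>\<bar>"
  have T: "T > 0" "T \<ge> b" "T \<ge> \<mu>" "T \<ge> - \<mu>" by (auto simp: T_def)
  have Hmono: "H x \<le> H y" if "f y \<le> f x" for x y using that by (simp add: fH)
  obtain c1 where c1: "c1 > 0" "\<And>t. T \<le> t \<Longrightarrow> c1 * t powr \<delta> \<le> H t"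
  proof (rule regvar_growth[of T H \<delta>])
    show "H x \<le> H y" if "T \<le> x" "x \<le> y" for x y
      using that T by (intro Hmono unimodal_right) auto
    show "2 powr \<delta> \<le> H (t * 2) / H t" if "T \<le> t" for t
      using b[of t] that T by simp
  qed (use T \<delta> in auto)
  obtain c2 where c2: "c2 > 0" "\<And>t. T \<le> t \<Longrightarrow> c2 * t powr \<delta> \<le> H (- t)"
  proof (rule regvar_growth[of T "\<lambda>t. H (- t)" \<delta>])
    show "H (- x) \<le> H (- y)" if "T \<le> x" "x \<le> y" for x y
      using that T by (intro Hmono unimodal_left) auto
    show "2 powr \<delta> \<le> H (- (t * 2)) / H (- t)" if "T \<le> t" for t
      using b[of "- t"] that T by simp
  qed (use T \<delta> in auto)
  have "min c1 c2 * \<bar>x\<bar> powr \<delta> \<le> H x" if "T \<le> \<bar>x\<bar>" for x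
  proof -
    have 1: "min c1 c2 * \<bar>x\<bar> powr \<delta> \<le> c1 * \<bar>x\<bar> powr \<delta>"
      and 2: "min c1 c2 * \<bar>x\<bar> powr \<delta> \<le> c2 * \<bar>x\<bar> powr \<delta>"
      by (auto intro!: mult_right_mono)
    show ?thesis
    proof (cases "x \<ge> 0")
      case True
      then show ?thesis using order_trans[OF 1 c1(2)[OF that]] by simp
    next
      case False
      then show ?thesis using order_trans[OF 2 c2(2)[OF that]] by simp
    qed
  qed
  then show thesis using that[of "min c1 c2" \<delta> T] c1(1) c2(1) \<delta>(1) by auto
qed

lemma rapid_f_powr:
  assumes "b > 0"
  shows "rapid (\<lambda>x. f x powr b)"
proof -
  obtain c \<delta> T where c: "c > 0" "\<delta> > 0" "\<And>x. T \<le> \<bar>x\<bar> \<Longrightarrow> c * \<bar>x\<bar> powr \<delta> \<le> H x" by (rule H_growth) blast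
  show ?thesis
  proof (rule rapid_of_tails[where B="f \<mu> powr b" and k="b * c" and \<delta>=\<delta> and T=T])
    show "f x powr b \<le> f \<mu> powr b" for x using f_le pos assms by (intro powr_mono2) (auto intro: less_imp_le)
    show "f x powr b \<le> exp (- (b * c) * \<bar>x\<bar> powr \<delta>)" if "T \<le> \<bar>x\<bar>" for x
      using mult_left_mono[OF c(3)[OF that], of b] assms by (simp add: fH powr_def mult.assoc)
  qed (use c assms in auto)
qed

lemma integrable_powr: "b > 0 \<Longrightarrow> integrable lborel (\<lambda>x. f x powr b)"
  using integrable_pbdd_rapid[OF rapid_f_powr pbdd_const[of 1], of b] by simp

lemma prob_space_P: "prob_space P"
  by (rule prob_space_stat_measure[OF pos]) (auto intro: integrable_powr beta_pos)

lemma integrable_P: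
  assumes "pbdd u" "u \<in> borel_measurable borel"
  shows "integrable P u"
  using integrable_pbdd_rapid[OF rapid_f_powr[OF beta_pos] assms(1) _ assms(2)] assms(2)
  by (intro integrable_stat_measure[OF pos]) (auto simp: mult.commute)

lemma tmean_eq: "u \<in> borel_measurable borel \<Longrightarrow> tmean f \<beta> u = (\<integral>x. u x \<partial>P)"
  by (subst integral_stat_measure[OF pos]) (auto simp: tmean_def divide_inverse mult.commute)

text \<open>Stein's identity: the derivative of \<open>(x - \<mu>) u(x) f(x)\<^sup>\<beta>\<close> integrates to zero.\<close>

lemma stein:
  assumes u: "\<And>x. (u has_real_derivative u' x) (at x)" and u': "\<And>x. isCont u' x"
    and pb: "pbdd u" "pbdd u'"
  shows "(\<integral>x. u x + (x - \<mu>) * u' x + \<beta> * (k x * u x) \<partial>P) = 0"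
proof -
  have cu: "isCont u x" for x using u by (blast intro: DERIV_isCont)
  have [measurable]: "u \<in> borel_measurable borel" "u' \<in> borel_measurable borel"
    using cu u' by (auto intro!: borel_measurable_continuous_onI continuous_at_imp_continuous_on)
  define v where "v x = u x + (x - \<mu>) * u' x + \<beta> * (k x * u x)" for x
  have [measurable]: "v \<in> borel_measurable borel" unfolding v_def[abs_def] by measurable
  have pbv: "pbdd v" unfolding v_def[abs_def] by (intro pbdd_intros pb pbdd_k)
  have fp: "f x powr \<beta> = exp (\<beta> * h x)" for x using pos[of x] by (simp add: powr_def hfun_def)
  have "(\<integral>x. v x * f x powr \<beta> \<partial>lborel) = 0"
  proof (rule integral_deriv_eq_0[where F="\<lambda>x. ((x - \<mu>) * u x) * f x powr \<beta>"])
    fix x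
    show "((\<lambda>x. ((x - \<mu>) * u x) * f x powr \<beta>) has_real_derivative v x * f x powr \<beta>) (at x)"
      unfolding fp v_def
      by (auto intro!: derivative_eq_intros u DERIV_h simp: kfun_def algebra_simps)
    show "isCont (\<lambda>x. v x * f x powr \<beta>) x"
      unfolding fp v_def kfun_def by (intro continuous_intros cu u' cont_h cont_h1)
  next
    show "integrable lborel (\<lambda>x. v x * f x powr \<beta>)"
      by (intro integrable_pbdd_rapid rapid_f_powr beta_pos pbv) measurable
    have "pbdd (\<lambda>x. (x - \<mu>) * u x)" by (intro pbdd_intros pb)
    from pbdd_rapid_tendsto_0[OF rapid_f_powr[OF beta_pos] this]
    show "((\<lambda>x. ((x - \<mu>) * u x) * f x powr \<beta>) \<longlongrightarrow> 0) at_top"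
      "((\<lambda>x. ((x - \<mu>) * u x) * f x powr \<beta>) \<longlongrightarrow> 0) at_bot" .
  qed
  then have "(\<integral>x. v x \<partial>P) = 0"
    by (subst integral_stat_measure[OF pos]) (auto simp: mult.commute)
  then show ?thesis unfolding v_def .
qed

text \<open>The derivative of \<open>swap_log\<close> at zero temperature increment:
  \<open>h\<close> comes from the changed exponent and \<open>- k / 2\<close> from the rescaling of
  the argument.\<close>

definition score :: "real \<Rightarrow> real" where "score x = h x - k x / 2"

definition score_var :: real where
  "score_var = (\<integral>x. (score x - (\<integral>x. score x \<partial>P))\<^sup>2 \<partial>P)"

lemma borel_score [measurable]: "score \<in> borel_measurable borel"
  unfolding score_def[abs_def] by measurable

lemma DERIV_k: "(k has_real_derivative h1 x + (x - \<mu>) * h2 x) (at x)"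
  unfolding kfun_def[abs_def] by (auto intro!: derivative_eq_intros DERIV_h1)

text \<open>Stein's identity for 1, \<open>h\<close> and \<open>k\<close> gives three linear
  relations. They eliminate the means of \<open>k\<close>, \<open>h * k\<close> and
  \<open>k * k\<close> from the expanded variance; in particular the square of \<open>k\<close> is
  traded for \<open>Rfun\<close>.\<close>

lemma score_var_eq: "score_var = Ifun f \<beta> - Vfun f \<mu> \<beta> / 2 - Rfun f \<mu> \<beta> / (4 * \<beta>)"
proof -
  interpret prob_space P by (rule prob_space_P)
  have [simp]: "prob UNIV = 1" using prob_space by simp
  have int [simp]: "integrable P h" "integrable P k" "integrable P r"
    "integrable P (\<lambda>x. h x * h x)" "integrable P (\<lambda>x. h x * k x)" "integrable P (\<lambda>x. k x * k x)"
    by (auto intro!: integrable_P pbdd_intros pbdd_h pbdd_k pbdd_r)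
  define eh ek er ehh ehk ekk where "eh = expectation h" and "ek = expectation k" and "er = expectation r"
    and "ehh = expectation (\<lambda>x. h x * h x)" and "ehk = expectation (\<lambda>x. h x * k x)"
    and "ekk = expectation (\<lambda>x. k x * k x)"
  note defs = eh_def ek_def er_def ehh_def ehk_def ekk_def
  have 1: "1 + \<beta> * ek = 0"
    using stein[of "\<lambda>x. 1" "\<lambda>x. 0"] by (simp add: defs pbdd_const prob_space)
  have 2: "eh + ek + \<beta> * ehk = 0"
  proof -
    have "(\<integral>x. h x + k x + \<beta> * (h x * k x) \<partial>P) = 0"
      using stein[OF DERIV_h cont_h1 pbdd_h pbdd_h1] by (simp add: kfun_def mult_ac)
    then show ?thesis by (simp add: defs)
  qed
  have 3: "ek + (ek + er) + \<beta> * ekk = 0"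
  proof -
    have "pbdd (\<lambda>x. h1 x + (x - \<mu>) * h2 x)" by (intro pbdd_intros pbdd_h1 pbdd_h2)
    moreover have "isCont (\<lambda>x. h1 x + (x - \<mu>) * h2 x) x" for x
      by (intro continuous_intros cont_h1 isCont_h2)
    ultimately have "(\<integral>x. k x + (x - \<mu>) * (h1 x + (x - \<mu>) * h2 x) + \<beta> * (k x * k x) \<partial>P) = 0"
      by (intro stein DERIV_k pbdd_k)
    also have "(\<lambda>x. k x + (x - \<mu>) * (h1 x + (x - \<mu>) * h2 x) + \<beta> * (k x * k x))
        = (\<lambda>x. k x + (k x + r x) + \<beta> * (k x * k x))"
      by (simp add: kfun_def rfun_def fun_eq_iff algebra_simps power2_eq_square)
    finally show ?thesis by (simp add: defs)
  qed
  have I: "Ifun f \<beta> = ehh - eh\<^sup>2"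
    unfolding Ifun_def by (subst (1 2) tmean_eq) (auto simp: defs power2_eq_square)
  have V: "Vfun f \<mu> \<beta> = ehk - eh * ek"
    unfolding Vfun_def by (subst (1 2 3) tmean_eq) (auto simp: defs)
  have R: "Rfun f \<mu> \<beta> = er - ek"
    unfolding Rfun_def by (subst tmean_eq) (auto simp: defs)
  have m: "expectation score = eh - ek / 2"
    unfolding score_def[abs_def] by (simp add: defs)
  define m where "m = eh - ek / 2"
  have "score_var = (\<integral>x. (score x - m)\<^sup>2 \<partial>P)" by (simp add: score_var_def m m_def)
  also have "\<dots> = (\<integral>x. h x * h x - h x * k x + k x * k x / 4 - 2 * m * h x + m * k x + m\<^sup>2 \<partial>P)"
    by (simp add: score_def power2_eq_square algebra_simps)
  also have "\<dots> = ehh - ehk + ekk / 4 - 2 * m * eh + m * ek + m\<^sup>2"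
    by (simp add: defs prob_space)
  also have "\<dots> = ehh - ehk + ekk / 4 - (eh - ek / 2)\<^sup>2"
    by (simp add: m_def power2_eq_square field_simps)
  also have "\<dots> = (ehh - eh\<^sup>2) - (ehk - eh * ek) / 2 - (er - ek) / (4 * \<beta>)"
  proof -
    have ek: "ek = - 1 / \<beta>" and ehk: "ehk = - (eh + ek) / \<beta>" and ekk: "ekk = - (2 * ek + er) / \<beta>"
      using 1 2 3 beta_pos by (simp_all add: field_simps)
    show ?thesis unfolding ehk ekk unfolding ek using beta_pos
      by (simp add: power2_eq_square field_simps)
  qed
  finally show ?thesis unfolding I V R .
qed

section \<open>Expansion and domination of the log ratio in the temperature step\<close>

lemma swap_log_deriv:
  "((\<lambda>e. swap_log f \<mu> \<beta> (\<beta> + e) x / e) \<longlongrightarrow> score x) (at 0)"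
proof -
  have sq: "((\<lambda>e. sqrt (\<beta> / (\<beta> + e))) has_real_derivative - (1 / (2 * \<beta>))) (at 0)"
    using beta_pos by (auto intro!: derivative_eq_intros simp: field_simps power2_eq_square)
  have g: "((\<lambda>e. sqrt (\<beta> / (\<beta> + e)) * (x - \<mu>) + \<mu>) has_real_derivative - (1 / (2 * \<beta>)) * (x - \<mu>)) (at 0)"
    using DERIV_add[OF DERIV_cmult_right[OF sq, of "x - \<mu>"] DERIV_const[of \<mu>]] by simp
  have g0: "sqrt (\<beta> / (\<beta> + 0)) * (x - \<mu>) + \<mu> = x" using beta_pos by simp
  have hg: "((\<lambda>e. h (sqrt (\<beta> / (\<beta> + e)) * (x - \<mu>) + \<mu>)) has_real_derivative h1 x * (- (1 / (2 * \<beta>)) * (x - \<mu>))) (at 0)"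
    by (rule DERIV_chain2[where f=h, OF _ g]) (use DERIV_h[of x] in \<open>simp only: g0\<close>)
  have "((\<lambda>e. (\<beta> + e) * h (sqrt (\<beta> / (\<beta> + e)) * (x - \<mu>) + \<mu>) - \<beta> * h x)
      has_real_derivative score x) (at 0)"
    by (rule DERIV_cong[OF DERIV_diff[OF DERIV_mult[OF DERIV_add[OF DERIV_const DERIV_ident] hg] DERIV_const]])
       (use beta_pos in \<open>simp add: score_def kfun_def field_simps\<close>)
  then have "((\<lambda>e. swap_log f \<mu> \<beta> (\<beta> + e) x) has_real_derivative score x) (at 0)"
    by (simp add: swap_log_def hfun_def)
  moreover have "swap_log f \<mu> \<beta> (\<beta> + 0) x = 0" using beta_pos by (simp add: swap_log_def)
  ultimately show ?thesis by (simp add: DERIV_def)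
qed

text \<open>With \<open>g\<close> the rescaled point, the log ratio is
  \<open>e * h g + \<beta> * (h g - h x)\<close>. The mean value inequality bounds the difference by
  a multiple of \<open>1 - \<theta>\<close>, and \<open>\<beta> * (1 - \<theta>) \<le> e\<close>
  makes both terms linear in \<open>e\<close> with polynomial coefficients.\<close>

lemma swap_log_bound:
  obtains B n where "\<And>e x. 0 < e \<Longrightarrow> \<bar>swap_log f \<mu> \<beta> (\<beta> + e) x\<bar> \<le> e * (B * (1 + \<bar>x\<bar>) ^ n)"
proof -
  obtain C1 n1 where C1: "C1 > 0" "\<And>x. \<bar>h x\<bar> \<le> C1 * (1 + \<bar>x\<bar>) ^ n1" using pbdd_h by (rule pbddE) blast
  obtain C2 n2 where C2: "C2 > 0" "\<And>x. \<bar>h1 x\<bar> \<le> C2 * (1 + \<bar>x\<bar>) ^ n2" using pbdd_h1 by (rule pbddE) blast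
  define a where "a = 1 + \<bar>\<mu>\<bar>"
  define C where "C = max C1 C2"
  define n where "n = max n1 n2"
  have C: "C > 0" using C1(1) by (simp add: C_def)
  have cb: "c * (1 + \<bar>y\<bar>) ^ m \<le> C * (a * (1 + \<bar>x\<bar>)) ^ n" if "\<bar>y\<bar> \<le> \<bar>x\<bar> + \<bar>\<mu>\<bar>" "0 < c" "c \<le> C" "m \<le> n" for c m x y
  proof -
    have "1 + \<bar>y\<bar> \<le> a * (1 + \<bar>x\<bar>)" using that(1) mult_nonneg_nonneg[OF abs_ge_zero[of \<mu>] abs_ge_zero[of x]]
      unfolding a_def distrib_left distrib_right mult_1 mult_1_right by linarith
    then have "(1 + \<bar>y\<bar>) ^ m \<le> (a * (1 + \<bar>x\<bar>)) ^ m" by (intro power_mono) auto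
    also have "\<dots> \<le> (a * (1 + \<bar>x\<bar>)) ^ n"
      using \<open>1 + \<bar>y\<bar> \<le> _\<close> that(4) by (intro power_increasing) linarith+
    finally show ?thesis using that by (intro mult_mono) auto
  qed
  have main: "\<bar>swap_log f \<mu> \<beta> (\<beta> + e) x\<bar> \<le> e * ((2 * C * a ^ Suc n) * (1 + \<bar>x\<bar>) ^ Suc n)" if e: "0 < e" for e x
  proof -
    define \<theta> where "\<theta> = sqrt (\<beta> / (\<beta> + e))"
    define g where "g = \<theta> * (x - \<mu>) + \<mu>"
    define K where "K = C * (a * (1 + \<bar>x\<bar>)) ^ n"
    have K: "K \<ge> 0" using C by (simp add: K_def a_def)
    have q: "0 \<le> \<beta> / (\<beta> + e)" "\<beta> / (\<beta> + e) \<le> 1" using beta_pos e by auto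
    have \<theta>: "0 \<le> \<theta>" "\<theta> \<le> 1" using q by (auto simp: \<theta>_def)
    have "\<theta> * \<theta> = \<beta> / (\<beta> + e)" by (simp only: \<theta>_def real_sqrt_mult_self abs_of_nonneg[OF q(1)])
    \<comment> \<open>Since \<open>0 \<le> \<theta> \<le> 1\<close>, the quantity
      \<open>1 - \<theta>\<close> is at most \<open>1 - \<theta> * \<theta>\<close>, which is
      rational in \<open>e\<close>.\<close>
    moreover have "\<theta> * \<theta> \<le> \<theta> * 1" using \<theta> by (intro mult_left_mono) auto
    ultimately have "1 - \<theta> \<le> 1 - \<beta> / (\<beta> + e)" by simp
    also have "\<dots> \<le> e / \<beta>" using beta_pos e by (simp add: field_simps)
    finally have th: "\<beta> * (1 - \<theta>) \<le> e" using beta_pos by (simp add: field_simps)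
    have seg: "\<bar>(1 - s) * x + s * \<mu>\<bar> \<le> \<bar>x\<bar> + \<bar>\<mu>\<bar>" if "0 \<le> s" "s \<le> 1" for s
    proof -
      have "\<bar>(1 - s) * x + s * \<mu>\<bar> \<le> (1 - s) * \<bar>x\<bar> + s * \<bar>\<mu>\<bar>"
        using that abs_triangle_ineq[of "(1 - s) * x" "s * \<mu>"] by (simp add: abs_mult)
      also have "\<dots> \<le> 1 * \<bar>x\<bar> + 1 * \<bar>\<mu>\<bar>" using that by (intro add_mono mult_right_mono) auto
      finally show ?thesis by simp
    qed
    have g: "g = (1 - (1 - \<theta>)) * x + (1 - \<theta>) * \<mu>" by (simp add: g_def algebra_simps)
    have gle: "\<bar>g\<bar> \<le> \<bar>x\<bar> + \<bar>\<mu>\<bar>" unfolding g using \<theta> by (intro seg) auto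
    have hg: "\<bar>h g\<bar> \<le> K" unfolding K_def
      by (rule order_trans[OF C1(2) cb]) (use gle C1 in \<open>auto simp: C_def n_def\<close>)
    have gx: "g - x = - ((1 - \<theta>) * (x - \<mu>))" by (simp add: g_def algebra_simps)
    have "\<bar>h g - h x\<bar> \<le> K * \<bar>g - x\<bar>"
      unfolding real_norm_def[symmetric]
    proof (rule field_differentiable_bound[where S="{-(\<bar>x\<bar> + \<bar>\<mu>\<bar>)..\<bar>x\<bar> + \<bar>\<mu>\<bar>}" and f'=h1])
      fix y assume "y \<in> {-(\<bar>x\<bar> + \<bar>\<mu>\<bar>)..\<bar>x\<bar> + \<bar>\<mu>\<bar>}"
      then have "\<bar>y\<bar> \<le> \<bar>x\<bar> + \<bar>\<mu>\<bar>" by auto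
      then show "norm (h1 y) \<le> K" unfolding K_def real_norm_def
        by (intro order_trans[OF C2(2) cb]) (use C2 in \<open>auto simp: C_def n_def\<close>)
    qed (use gle in \<open>auto intro: has_field_derivative_at_within DERIV_h\<close>)
    then have hgx: "\<bar>h g - h x\<bar> \<le> K * ((1 - \<theta>) * \<bar>x - \<mu>\<bar>)"
      unfolding gx using \<theta> by (simp add: abs_mult)
    have "\<bar>x - \<mu>\<bar> \<le> a * (1 + \<bar>x\<bar>)" "1 \<le> a * (1 + \<bar>x\<bar>)"
      using abs_triangle_ineq4[of x \<mu>] mult_nonneg_nonneg[OF abs_ge_zero[of \<mu>] abs_ge_zero[of x]]
      unfolding a_def distrib_left distrib_right mult_1 mult_1_right by linarith+
    note A = this
    have "swap_log f \<mu> \<beta> (\<beta> + e) x = e * h g + \<beta> * (h g - h x)"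
      by (simp add: swap_log_def g_def \<theta>_def hfun_def algebra_simps)
    also have "\<bar>\<dots>\<bar> \<le> e * \<bar>h g\<bar> + \<beta> * \<bar>h g - h x\<bar>"
      using abs_triangle_ineq[of "e * h g" "\<beta> * (h g - h x)"] e beta_pos by (simp add: abs_mult)
    also have "\<dots> \<le> e * K + \<beta> * (K * ((1 - \<theta>) * \<bar>x - \<mu>\<bar>))"
      using e beta_pos by (intro add_mono mult_left_mono hg hgx) auto
    also have "\<beta> * (K * ((1 - \<theta>) * \<bar>x - \<mu>\<bar>)) = (\<beta> * (1 - \<theta>)) * (K * \<bar>x - \<mu>\<bar>)" by simp
    also have "\<dots> \<le> e * (K * (a * (1 + \<bar>x\<bar>)))"
      using K th A(1) e by (intro mult_mono) auto
    also have "e * K \<le> e * (K * (a * (1 + \<bar>x\<bar>)))"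
      using K e A(2) mult_left_mono[OF A(2) K] by (intro mult_left_mono) auto
    finally show ?thesis by (simp add: K_def power_mult_distrib mult_ac)
  qed
  show thesis by (rule that[OF main])
qed

text \<open>For \<open>e \<le> 3 * \<beta>\<close> the scaling factor is at least
  \<open>sqrt (1 / 4)\<close>, so the rescaled point is no closer to \<open>\<mu>\<close> than the
  midpoint, and unimodality bounds \<open>f\<close> by its midpoint value. The first factor bounds
  the surplus power \<open>e\<close> of \<open>f\<close>; \<open>max 1\<close> makes it monotone in
  the exponent.\<close>

definition envelope :: "real \<Rightarrow> real" where
  "envelope x = max 1 (f \<mu>) powr (3 * \<beta>) * (f ((x + \<mu>) / 2) powr \<beta> / f x powr \<beta>)"

lemma exp_swap_log_le:
  assumes "0 < e" "e \<le> 3 * \<beta>"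
  shows "exp (swap_log f \<mu> \<beta> (\<beta> + e) x) \<le> envelope x"
proof -
  define \<theta> where "\<theta> = sqrt (\<beta> / (\<beta> + e))"
  define g where "g = \<theta> * (x - \<mu>) + \<mu>"
  have "sqrt (1 / 4) \<le> \<theta>" unfolding \<theta>_def
    using assms beta_pos by (intro real_sqrt_le_mono) (simp add: field_simps)
  then have \<theta>: "1 / 2 \<le> \<theta>" by (simp add: real_sqrt_divide)
  have "f g \<le> f ((x + \<mu>) / 2)"
  proof (cases "x \<ge> \<mu>")
    case True
    then have "1 / 2 * (x - \<mu>) \<le> \<theta> * (x - \<mu>)" using \<theta> by (intro mult_right_mono) auto
    then show ?thesis using True by (intro unimodal_right) (auto simp: g_def field_simps)
  next
    case False
    then have "\<theta> * (x - \<mu>) \<le> 1 / 2 * (x - \<mu>)" using \<theta> by (intro mult_right_mono_neg) auto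
    then show ?thesis using False by (intro unimodal_left) (auto simp: g_def field_simps)
  qed
  then have 1: "f g powr \<beta> \<le> f ((x + \<mu>) / 2) powr \<beta>"
    using pos[of g] beta_pos by (intro powr_mono2) auto
  have "f g powr e \<le> max 1 (f \<mu>) powr e"
    using pos[of g] f_le[of g] assms by (intro powr_mono2) auto
  also have "\<dots> \<le> max 1 (f \<mu>) powr (3 * \<beta>)" using assms by (intro powr_mono) auto
  finally have 2: "f g powr e \<le> max 1 (f \<mu>) powr (3 * \<beta>)" .
  have "exp (swap_log f \<mu> \<beta> (\<beta> + e) x) = (f g powr e * f g powr \<beta>) / f x powr \<beta>"
    using pos[of g, THEN less_imp_neq] pos[of x, THEN less_imp_neq]
    by (simp add: swap_log_def g_def[symmetric] \<theta>_def[symmetric] powr_def exp_diff exp_add distrib_right mult.commute)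
  also have "\<dots> \<le> (max 1 (f \<mu>) powr (3 * \<beta>) * f ((x + \<mu>) / 2) powr \<beta>) / f x powr \<beta>"
    by (intro divide_right_mono mult_mono 1 2) auto
  finally show ?thesis by (simp add: envelope_def)
qed

lemma borel_envelope [measurable]: "envelope \<in> borel_measurable borel"
  unfolding envelope_def[abs_def] by measurable

lemma borel_swap_log [measurable]: "swap_log f \<mu> b b' \<in> borel_measurable borel"
  unfolding swap_log_def[abs_def] by measurable

text \<open>The denominator \<open>f x powr \<beta>\<close> of the envelope cancels against the
  density of \<open>P\<close>, leaving polynomial growth times rapidly decaying functions.\<close>

lemma integrable_envelope:
  assumes "pbdd u" and [measurable]: "u \<in> borel_measurable borel"
  shows "integrable P (\<lambda>x. u x * (1 + envelope x))"
proof (rule integrable_stat_measure[OF pos])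
  let ?c = "max 1 (f \<mu>) powr (3 * \<beta>)"
  have "integrable lborel (\<lambda>x. u x * f x powr \<beta> + ?c * (u x * f ((x + \<mu>) / 2) powr \<beta>))"
    using rapid_rescale[OF rapid_f_powr[OF beta_pos], of \<mu>]
    by (intro Bochner_Integration.integrable_add integrable_mult_right integrable_pbdd_rapid
        rapid_f_powr beta_pos assms) auto
  also have "(\<lambda>x. u x * f x powr \<beta> + ?c * (u x * f ((x + \<mu>) / 2) powr \<beta>))
      = (\<lambda>x. f x powr \<beta> *\<^sub>R (u x * (1 + envelope x)))"
    using pos[THEN less_imp_neq] by (auto simp: envelope_def fun_eq_iff field_simps)
  finally show "integrable lborel (\<lambda>x. f x powr \<beta> *\<^sub>R (u x * (1 + envelope x)))" .
qed measurable

lemma likelihood_family_swap: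
  assumes e: "\<And>n. 0 < \<epsilon> n" "\<And>n. \<epsilon> n \<le> 3 * \<beta>" "\<epsilon> \<longlonglongrightarrow> 0"
  shows "\<exists>W. likelihood_family P (\<lambda>n. swap_log f \<mu> \<beta> (\<beta> + \<epsilon> n)) score W envelope \<epsilon>"
proof -
  obtain B n where B: "\<And>e x. 0 < e \<Longrightarrow> \<bar>swap_log f \<mu> \<beta> (\<beta> + e) x\<bar> \<le> e * (B * (1 + \<bar>x\<bar>) ^ n)"
    by (rule swap_log_bound) blast
  interpret prob_space P by (rule prob_space_P)
  have mP: "borel_measurable P = (borel_measurable borel :: (real \<Rightarrow> real) set)"
    by (rule measurable_cong_sets) auto
  have "likelihood_family P (\<lambda>n. swap_log f \<mu> \<beta> (\<beta> + \<epsilon> n)) score (\<lambda>x. B * (1 + \<bar>x\<bar>) ^ n) envelope \<epsilon>"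
  proof
    show "(\<lambda>n. swap_log f \<mu> \<beta> (\<beta> + \<epsilon> n) x / \<epsilon> n) \<longlonglongrightarrow> score x" for x
      by (rule filterlim_compose[OF swap_log_deriv])
         (use e in \<open>auto simp: filterlim_at less_imp_neq[OF e(1), symmetric]\<close>)
    show "integrable P (\<lambda>x. (1 + B * (1 + \<bar>x\<bar>) ^ n)\<^sup>2 * (1 + envelope x))"
      by (intro integrable_envelope pbdd_intros) measurable
  qed (use e B exp_swap_log_le in \<open>simp_all add: mP\<close>)
  then show ?thesis by blast
qed


section \<open>The limiting acceptance rate and its value at the optimum\<close>

definition swap_law :: "real \<Rightarrow> nat \<Rightarrow> real measure" where
  "swap_law e d = distr (PiM {..<d} (\<lambda>_. P) \<Otimes>\<^sub>M PiM {..<d} (\<lambda>_. stat_measure f (\<beta> + e))) borel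
    (\<lambda>(x, y). (\<Sum>i<d. swap_log f \<mu> \<beta> (\<beta> + e) (x i))
      + (\<Sum>i<d. - swap_log f \<mu> \<beta> (\<beta> + e) (sqrt ((\<beta> + e) / \<beta>) * (y i - \<mu>) + \<mu>)))"

lemma swap_law:
  assumes "0 < e"
  shows real_distribution_swap_law: "real_distribution (swap_law e d)"
    and char_swap_law: "char (swap_law e d) t = ((\<integral>x. iexp (t * swap_log f \<mu> \<beta> (\<beta> + e) x) \<partial>P) *
      ((\<integral>x. exp (swap_log f \<mu> \<beta> (\<beta> + e) x) * iexp (- (t * swap_log f \<mu> \<beta> (\<beta> + e) x)) \<partial>P)
        / (\<integral>x. exp (swap_log f \<mu> \<beta> (\<beta> + e) x) \<partial>P))) ^ d"
    and integral_swap_law: "l = e * sqrt d \<Longrightarrow> d > 0 \<Longrightarrow>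
      exp_acc f \<mu> \<beta> l d = (\<integral>z. min 1 (exp z) \<partial>swap_law e d)"
proof -
  let ?\<phi> = "swap_log f \<mu> \<beta> (\<beta> + e)"
  let ?\<psi> = "\<lambda>y. - ?\<phi> (sqrt ((\<beta> + e) / \<beta>) * (y - \<mu>) + \<mu>)"
  have be: "\<beta> + e > 0" using assms beta_pos by simp
  have P': "prob_space (stat_measure f (\<beta> + e))"
    by (rule prob_space_stat_measure[OF pos]) (auto intro: integrable_powr be)
  have m: "?\<psi> \<in> borel_measurable borel" by measurable
  note cps = char_product_sum[OF prob_space_P sets_stat_measure P' sets_stat_measure borel_swap_log m]
  interpret \<Omega>: prob_space "PiM {..<d} (\<lambda>_. P) \<Otimes>\<^sub>M PiM {..<d} (\<lambda>_. stat_measure f (\<beta> + e))"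
    by (rule cps(1))
  show "real_distribution (swap_law e d)"
    unfolding swap_law_def by (rule \<Omega>.real_distribution_distr[OF cps(2)])
  have "(\<lambda>z. iexp (t * - z)) \<in> borel_measurable borel" by measurable
  from integral_swap[OF pos borel_f this beta_pos be integrable_powr[OF beta_pos], of \<mu>]
  have "(\<integral>y. iexp (t * ?\<psi> y) \<partial>stat_measure f (\<beta> + e))
    = (\<integral>x. exp (?\<phi> x) * iexp (- (t * ?\<phi> x)) \<partial>P) / (\<integral>x. exp (?\<phi> x) \<partial>P)"
    by simp
  then show "char (swap_law e d) t = ((\<integral>x. iexp (t * ?\<phi> x) \<partial>P) *
      ((\<integral>x. exp (?\<phi> x) * iexp (- (t * ?\<phi> x)) \<partial>P) / (\<integral>x. exp (?\<phi> x) \<partial>P))) ^ d"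
    unfolding swap_law_def cps(3) power_mult_distrib by (simp only:)
  assume l: "l = e * sqrt d" "d > 0"
  then have le: "l / sqrt (real d) = e" by simp
  show "exp_acc f \<mu> \<beta> l d = (\<integral>z. min 1 (exp z) \<partial>swap_law e d)"
    unfolding exp_acc_def le Let_def swap_law_def swap_acc_eq[OF pos beta_pos be]
    by (subst integral_distr[OF cps(2)]) (auto intro!: Bochner_Integration.integral_cong)
qed

lemma score_var_nonneg: "score_var \<ge> 0"
  unfolding score_var_def by (rule integral_nonneg_AE) simp

lemma exp_acc_limit:
  assumes l: "l > 0"
  shows "(\<lambda>d. exp_acc f \<mu> \<beta> l d) \<longlonglongrightarrow> 2 * Phi (- l * sqrt score_var / sqrt 2)"
proof -
  \<comment> \<open>Starting at dimension \<open>d0\<close> makes every step at most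
    \<open>3 * \<beta>\<close>, the range of the envelope; the shift is undone at the end by
    \<open>LIMSEQ_offset\<close>.\<close>
  obtain d0 :: nat where d0: "(l / (3 * \<beta>))\<^sup>2 < d0" using reals_Archimedean2 by blast
  have d0_pos: "d0 > 0" using le_less_trans[OF zero_le_power2 d0] by simp
  define \<epsilon> where "\<epsilon> n = l / sqrt (real (n + d0))" for n
  have sq_pos: "sqrt (real (n + d0)) > 0" for n using d0_pos by simp
  have e1: "0 < \<epsilon> n" for n using l sq_pos by (simp add: \<epsilon>_def)
  have e2: "\<epsilon> n \<le> 3 * \<beta>" for n
  proof -
    have "l / (3 * \<beta>) \<le> sqrt (real (n + d0))"
      using d0 by (intro real_le_rsqrt) simp
    then show ?thesis using sq_pos[of n] beta_pos by (simp add: \<epsilon>_def field_simps)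
  qed
  have e3: "\<epsilon> \<longlonglongrightarrow> 0"
    unfolding \<epsilon>_def[abs_def] by real_asymp
  obtain W where "likelihood_family P (\<lambda>n. swap_log f \<mu> \<beta> (\<beta> + \<epsilon> n)) score W envelope \<epsilon>"
    using likelihood_family_swap[OF e1 e2 e3] by blast
  then interpret L: likelihood_family P "\<lambda>n. swap_log f \<mu> \<beta> (\<beta> + \<epsilon> n)" score W envelope \<epsilon> .
  have v: "(\<integral>x. (score x - L.smean)\<^sup>2 \<partial>P) = score_var"
    by (simp add: score_var_def L.smean_def)
  \<comment> \<open>The limit law is that of \<open>w * X - w\<^sup>2 / 2\<close> with
    \<open>X\<close> standard normal. The degenerate case \<open>w = 0\<close>, a point mass at 0,
    is included.\<close>
  define w where "w = sqrt (2 * (l\<^sup>2 * score_var))"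
  have w2: "w\<^sup>2 = 2 * (l\<^sup>2 * score_var)" and w0: "w \<ge> 0" using score_var_nonneg by (auto simp: w_def)
  define N where "N = distr std_normal_distribution borel (\<lambda>x. w * x - w\<^sup>2 / 2)"
  interpret Z: real_distribution std_normal_distribution by (rule real_dist_normal_dist)
  have rdN: "real_distribution N"
    unfolding N_def by (rule Z.real_distribution_distr) simp
  have charN: "char N t = exp (- (\<i> * t + of_real (t\<^sup>2)) * (l\<^sup>2 * score_var))" for t
  proof -
    have "char N t = (\<integral>x. iexp (t * (w * x - w\<^sup>2 / 2)) \<partial>std_normal_distribution)"
      unfolding char_def N_def by (subst integral_distr) auto
    also have "\<dots> = (\<integral>x. iexp (- (t * w\<^sup>2 / 2)) * iexp ((t * w) * x) \<partial>std_normal_distribution)"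
      by (simp add: algebra_simps flip: exp_add)
    also have "\<dots> = iexp (- (t * w\<^sup>2 / 2)) * char std_normal_distribution (t * w)"
      unfolding char_def by (rule integral_mult_right_zero)
    also have "\<dots> = exp (- (\<i> * t + of_real (t\<^sup>2)) * (l\<^sup>2 * score_var))"
      unfolding char_std_normal_distribution power_mult_distrib w2
      by (simp add: exp_of_real[symmetric] exp_add[symmetric] algebra_simps del: exp_of_real)
    finally show ?thesis .
  qed
  have Df: "filterlim (\<lambda>n. n + d0) at_top sequentially" by (rule filterlim_add_const_nat_at_top)
  have lD: "real (n + d0) * (\<epsilon> n)\<^sup>2 = l\<^sup>2" for n
    using d0_pos by (simp add: \<epsilon>_def power_divide)
  have conv: "weak_conv_m (\<lambda>n. swap_law (\<epsilon> n) (n + d0)) N"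
  proof (rule levy_continuity)
    fix t
    show "(\<lambda>n. char (swap_law (\<epsilon> n) (n + d0)) t) \<longlonglongrightarrow> char N t"
      using L.char_limit[OF Df lD, of t] unfolding char_swap_law[OF e1] charN v L.norm_const_def .
  qed (use real_distribution_swap_law e1 rdN in auto)
  \<comment> \<open>The map \<open>\<lambda>z. min 1 (exp z)\<close> is continuous and bounded, so
    weak convergence passes to its expectation.\<close>
  have "(\<lambda>n. \<integral>z. min 1 (exp z) \<partial>swap_law (\<epsilon> n) (n + d0)) \<longlonglongrightarrow> (\<integral>z. min 1 (exp z) \<partial>N)"
    by (rule weak_conv_imp_integral_bdd_continuous_conv[OF real_distribution_swap_law[OF e1] rdN conv, where B=1])
       (auto intro!: continuous_intros)
  moreover have "(\<integral>z. min 1 (exp z) \<partial>N) = 2 * Phi (- l * sqrt score_var / sqrt 2)"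
  proof -
    have "(\<integral>z. min 1 (exp z) \<partial>N) = (\<integral>x. min 1 (exp (w * x - w\<^sup>2 / 2)) \<partial>std_normal_distribution)"
      unfolding N_def by (subst integral_distr) auto
    also have "\<dots> = 2 * Phi (- w / 2)" by (rule integral_min_exp_std_normal[OF w0])
    also have "w = sqrt 2 * (l * sqrt score_var)"
      using l by (simp add: w_def real_sqrt_mult)
    also have "- (sqrt 2 * (l * sqrt score_var)) / 2 = - l * sqrt score_var / sqrt 2"
      by (simp add: field_simps)
    finally show ?thesis .
  qed
  moreover have "(\<integral>z. min 1 (exp z) \<partial>swap_law (\<epsilon> n) (n + d0)) = exp_acc f \<mu> \<beta> l (n + d0)" for n
    using sq_pos[of n] d0_pos by (intro integral_swap_law[symmetric] e1) (auto simp: \<epsilon>_def)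
  ultimately have "(\<lambda>n. exp_acc f \<mu> \<beta> l (n + d0)) \<longlonglongrightarrow> 2 * Phi (- l * sqrt score_var / sqrt 2)"
    by simp
  then show ?thesis by (rule LIMSEQ_offset)
qed

lemma ESJD_limit:
  assumes "l > 0"
  shows "(\<lambda>d. real d * ESJD f \<mu> \<beta> l d) \<longlonglongrightarrow> eff_lim f \<mu> \<beta> l"
proof -
  have "(\<lambda>d. l\<^sup>2 * exp_acc f \<mu> \<beta> l d) \<longlonglongrightarrow> l\<^sup>2 * (2 * Phi (- l * sqrt score_var / sqrt 2))"
    by (intro tendsto_mult_left exp_acc_limit assms)
  \<comment> \<open>The equation is asserted for \<open>d > 0\<close> only: at 0 the factor
    \<open>real d\<close> annihilates the right-hand side.\<close>
  moreover have "\<forall>\<^sub>F d in sequentially. l\<^sup>2 * exp_acc f \<mu> \<beta> l d = real d * ESJD f \<mu> \<beta> l d"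
    using eventually_gt_at_top[of 0] by eventually_elim (simp add: ESJD_def power_divide)
  ultimately have "(\<lambda>d. real d * ESJD f \<mu> \<beta> l d) \<longlonglongrightarrow> l\<^sup>2 * (2 * Phi (- l * sqrt score_var / sqrt 2))"
    by (rule Lim_transform_eventually)
  then show ?thesis unfolding eff_lim_def score_var_eq[symmetric] by (simp add: mult_ac)
qed

lemma optimal_exp_acc:
  assumes lo: "lo > 0" and max: "\<And>l. l > 0 \<Longrightarrow> eff_lim f \<mu> \<beta> l \<le> eff_lim f \<mu> \<beta> lo"
  shows "\<exists>a. (\<lambda>d. exp_acc f \<mu> \<beta> lo d) \<longlonglongrightarrow> a \<and> 0.2335 \<le> a \<and> a < 0.2345"
proof -
  define \<kappa> where "\<kappa> = sqrt score_var / sqrt 2"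
  have eff: "eff_lim f \<mu> \<beta> l = 2 * l\<^sup>2 * Phi (- l * \<kappa>)" for l
    unfolding eff_lim_def score_var_eq[symmetric] by (simp add: \<kappa>_def)
  have "\<kappa> \<noteq> 0"
  \<comment> \<open>With \<open>\<kappa> = 0\<close> the limiting efficiency is the square of
    \<open>l\<close>, which has no maximiser; the existence of \<open>lo\<close> thus excludes a
    degenerate score.\<close>
  proof
    assume "\<kappa> = 0"
    then have "(lo + 1)\<^sup>2 \<le> lo\<^sup>2" using max[of "lo + 1"] lo by (simp add: eff Phi_0)
    then show False using lo by (simp add: power2_eq_square algebra_simps)
  qed
  then have \<kappa>: "\<kappa> > 0" using score_var_nonneg by (simp add: \<kappa>_def)
  have "opt_gap (lo * \<kappa>) = 0"
    by (rule opt_gap_maximiser[OF \<kappa> lo]) (use max in \<open>simp add: eff\<close>)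
  from optimal_acceptance_rate[OF _ this] have "0.2335 \<le> 2 * Phi (- (lo * \<kappa>))" "2 * Phi (- (lo * \<kappa>)) < 0.2345"
    using lo \<kappa> by auto
  moreover have "(\<lambda>d. exp_acc f \<mu> \<beta> lo d) \<longlonglongrightarrow> 2 * Phi (- (lo * \<kappa>))"
    using exp_acc_limit[OF lo] by (simp add: \<kappa>_def)
  ultimately show ?thesis by blast
qed

end

theorem theorem1:
  fixes f H :: "real \<Rightarrow> real" and \<mu> \<alpha> M \<beta> :: real
  assumes pos: "\<And>x. f x > 0"
    and smooth: "C4 f"
    and unimodal_left: "\<And>x y. x \<le> y \<Longrightarrow> y \<le> \<mu> \<Longrightarrow> f x \<le> f y"
    and unimodal_right: "\<And>x y. \<mu> \<le> x \<Longrightarrow> x \<le> y \<Longrightarrow> f y \<le> f x"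
    and fH: "\<And>x. f x = exp (- H x)"
    and alpha_pos: "\<alpha> > 0"
    and regvar: "\<And>x. x > 0 \<Longrightarrow> ((\<lambda>t. H (t * x) / H t) \<longlongrightarrow> x powr \<alpha>) at_infinity"
    and M_pos: "M > 0"
    and bound4: "\<And>z. \<bar>(deriv ^^ 4) (hfun f) z\<bar> < M"
    and beta_pos: "\<beta> > 0"
  shows "(\<forall>l>0. (\<lambda>d. real d * ESJD f \<mu> \<beta> l d) \<longlonglongrightarrow> eff_lim f \<mu> \<beta> l)
       \<and> (\<forall>lopt>0. (\<forall>l>0. eff_lim f \<mu> \<beta> l \<le> eff_lim f \<mu> \<beta> lopt) \<longrightarrow>
            (\<exists>a. (\<lambda>d. exp_acc f \<mu> \<beta> lopt d) \<longlonglongrightarrow> a \<and> 0.2335 \<le> a \<and> a < 0.2345))"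
proof -
  interpret swap_target f H \<mu> \<alpha> M \<beta>
    by standard (fact assms)+
  show ?thesis using ESJD_limit optimal_exp_acc by blast
qed

end
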